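(* Let $q$ be a prime power, $\mathcal A=\mathbb F_q^N$, $\mathsf M=q^m$ with $m\le N$, $\mathcal E$ a finite set, $Q_E$ a probability distribution on $\mathcal E$, $P_{A,E}$ a sub-distribution on $\mathcal A\times\mathcal E$, and let $f_{\mathbf X}$ be a linear random hash function from $\mathcal A$ to $\mathbb F_q^m\cong\{1,\dots,\mathsf M\}$ that is $\varepsilon$-almost dual universal$_2$. Then $$\mathrm E_{\mathbf X}\,d_1'(f_{\mathbf X}(A)|E|P_{A,E})\le \sqrt{\varepsilon}\,\mathsf M^{1/2}e^{-\frac12 H_2(A|E|P_{A,E}\|Q_E)},\qquad \mathrm E_{\mathbf X}\,d_1'(f_{\mathbf X}(A)|E|P_{A,E})\le\Delta_{d,2}(\mathsf M,\varepsilon|P_{A,E}).$$ When $P_{A,E}$ is a normalized joint distribution, $$\mathrm E_{\mathbf X}\,I'(f_{\mathbf X}(A)|E|P_{A,E})\le\log\bigl(1+\varepsilon\mathsf M e^{-H_2^{\downarrow}(A|E|P_{A,E})}\bigr)\le\varepsilon\mathsf M e^{-H_2^{\downarrow}(A|E|P_{A,E})},\qquad \mathrm E_{\mathbf X}\,I'(f_{\mathbf X}(A)|E|P_{A,E})\le\Delta_{I,2}(\mathsf M,\varepsilon|P_{A,E}).$$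
   Context: All sets are finite and logarithms natural. A sub-distribution is a nonnegative function with total sum $\le 1$; $P_E(e)=\sum_aP_{A,E}(a,e)$; $\|\cdot\|_1$ is the sum of absolute values. Hash functions: $\mathbf X$ is a random variable (independent of $(A,E)$); for each value $x$, $f_x:\mathbb F_q^N\to\mathbb F_q^m$ is an $\mathbb F_q$-linear map with kernel $C_x$ (of dimension $N-m$ or more), and $C_x^\perp=\{y\in\mathbb F_q^N:\sum_iy_iz_i=0\ \forall z\in C_x\}$ is the dual code. $f_{\mathbf X}$ is $\varepsilon$-almost dual universal$_2$ if the kernels have minimum dimension $\min_x\dim C_x=N-m$ (equivalently, the dual codes $C_x^\perp$ have maximum dimension $m$) and $\Pr[y\in C_{\mathbf X}^\perp]\le\varepsilon q^{m-N}$ for all $y\in\mathbb F_q^N\setminus\{0\}$. For a map $f$ from $\mathcal A$ to an $\mathsf M$-element set, $P_{f(A),E}(b,e)=\sum_{a:f(a)=b}P_{A,E}(a,e)$, $d_1'(f(A)|E|P_{A,E})=\sum_{b,e}|P_{f(A),E}(b,e)-P_E(e)/\mathsf M|$, and (for normalized $P_{A,E}$) $I'(f(A)|E|P_{A,E})=\sum_{b,e}P_{f(A),E}(b,e)\log\frac{\mathsf M P_{f(A),E}(b,e)}{P_E(e)}$. $H_2(A|E|P\|Q_E)=-\log\sum_{a,e}P(a,e)^2Q_E(e)^{-1}$ (with $0/0=0$ and value $-\infty$ if $P(a,e)>0=Q_E(e)$ for some $(a,e)$); $H_2^\downarrow(A|E|P)=H_2(A|E|P\|P_E)$ for normalized $P$.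 $\eta(x,y)=xy-x\log x$. With minima understood as infima, $$\Delta_{d,2}(\mathsf M,\varepsilon|P_{A,E})=\min_{Q_E}\min_{P'_{A,E}}\Bigl[2\|P_{A,E}-P'_{A,E}\|_1+\sqrt\varepsilon\,\mathsf M^{1/2}e^{-\frac12H_2(A|E|P'_{A,E}\|Q_E)}\Bigr],$$ $$\Delta_{I,2}(\mathsf M,\varepsilon|P_{A,E})=\min_{P'_{A,E}:\,P'_E\le P_E}\Bigl[\eta(\|P_{A,E}-P'_{A,E}\|_1,\log\mathsf M)+\varepsilon\mathsf M e^{-H_2(A|E|P'_{A,E}\|P_E)}\Bigr],$$ where $Q_E$ ranges over probability distributions on $\mathcal E$ and $P'_{A,E}$ over sub-distributions on $\mathcal A\times\mathcal E$.
   Formalization: Each hash map f_x is additionally assumed surjective onto F_q^m, and the minimum defining Δ_{I,2} is taken only over P' with ‖P−P'‖₁ ≤ 1/2; without either of these the claim is false. *)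

theory Defs
  imports
    "Jordan_Normal_Form.VS_Connect"
    "HOL-Probability.Probability_Mass_Function"
begin

text \<open>
  The finite field is a type \<open>'k\<close> of sort \<open>{field, finite}\<close> with \<open>q = CARD('k)\<close>, and the space of
  vectors of length \<open>n\<close> over it is \<open>carrier_vec n\<close>. The type \<open>vec\<close> is always \<open>Matrix.vec\<close>, not the
  type of the same name from Finite_Cartesian_Product.

  A function on a finite set is a HOL function of which only the values on that set matter: all sums
  and conditions below are restricted to the alphabets \<open>A\<close> and \<open>E\<close>.
\<close>

definition subdist_on :: "'s set \<Rightarrow> ('s \<Rightarrow> real) \<Rightarrow> bool" where
  "subdist_on S P \<longleftrightarrow> (\<forall>s\<in>S. 0 \<le> P s) \<and> sum P S \<le> 1"

definition dist_on :: "'s set \<Rightarrow> ('s \<Rightarrow> real) \<Rightarrow> bool" where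
  "dist_on S P \<longleftrightarrow> (\<forall>s\<in>S. 0 \<le> P s) \<and> sum P S = 1"

definition marginal :: "'a set \<Rightarrow> ('a \<times> 'e \<Rightarrow> real) \<Rightarrow> 'e \<Rightarrow> real" where
  "marginal A P e = (\<Sum>a\<in>A. P (a, e))"

definition l1_dist :: "'s set \<Rightarrow> ('s \<Rightarrow> real) \<Rightarrow> ('s \<Rightarrow> real) \<Rightarrow> real" where
  "l1_dist S P P' = (\<Sum>s\<in>S. \<bar>P s - P' s\<bar>)"

definition push :: "('a \<Rightarrow> 'b) \<Rightarrow> 'a set \<Rightarrow> ('a \<times> 'e \<Rightarrow> real) \<Rightarrow> 'b \<times> 'e \<Rightarrow> real" where
  "push f A P = (\<lambda>(b, e). \<Sum>a\<in>{a \<in> A. f a = b}. P (a, e))"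

text \<open>In the next two definitions \<open>B\<close> is the codomain of \<open>f\<close>, so the constant M is \<open>card B\<close>.\<close>

definition d1' :: "'a set \<Rightarrow> 'e set \<Rightarrow> 'b set \<Rightarrow> ('a \<Rightarrow> 'b) \<Rightarrow> ('a \<times> 'e \<Rightarrow> real) \<Rightarrow> real" where
  "d1' A E B f P =
     (\<Sum>b\<in>B. \<Sum>e\<in>E. \<bar>push f A P (b, e) - marginal A P e / real (card B)\<bar>)"

text \<open>A summand with \<open>push f A P (b, e) = 0\<close> is 0; this covers \<open>marginal A P e = 0\<close>.\<close>

definition I' :: "'a set \<Rightarrow> 'e set \<Rightarrow> 'b set \<Rightarrow> ('a \<Rightarrow> 'b) \<Rightarrow> ('a \<times> 'e \<Rightarrow> real) \<Rightarrow> real" where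
  "I' A E B f P =
     (\<Sum>b\<in>B. \<Sum>e\<in>E. push f A P (b, e) *
        ln (real (card B) * push f A P (b, e) / marginal A P e))"

definition ereal_ln :: "ereal \<Rightarrow> ereal" where
  "ereal_ln x = (if x = \<infinity> then \<infinity> else if x \<le> 0 then -\<infinity> else ereal (ln (real_of_ereal x)))"

definition ereal_exp :: "ereal \<Rightarrow> ereal" where
  "ereal_exp x = (if x = \<infinity> then \<infinity> else if x = -\<infinity> then 0 else ereal (exp (real_of_ereal x)))"

text \<open>
  Division on \<open>ereal\<close> satisfies \<open>0 / 0 = 0\<close> and \<open>r / 0 = \<infinity>\<close> for \<open>r > 0\<close>. Hence the value is \<open>-\<infinity>\<close>
  exactly when \<open>P (a, e) > 0 = Q e\<close> for some \<open>(a, e)\<close>, and it is \<open>\<infinity>\<close> exactly when \<open>P\<close> vanishes.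
\<close>

definition H2 :: "'a set \<Rightarrow> 'e set \<Rightarrow> ('a \<times> 'e \<Rightarrow> real) \<Rightarrow> ('e \<Rightarrow> real) \<Rightarrow> ereal" where
  "H2 A E P Q = - ereal_ln (\<Sum>a\<in>A. \<Sum>e\<in>E. ereal ((P (a, e))\<^sup>2) / ereal (Q e))"

definition H2_down :: "'a set \<Rightarrow> 'e set \<Rightarrow> ('a \<times> 'e \<Rightarrow> real) \<Rightarrow> ereal" where
  "H2_down A E P = H2 A E P (marginal A P)"

definition eta :: "real \<Rightarrow> real \<Rightarrow> real" where
  "eta x y = x * y - x * ln x"

definition Delta_d2 ::
  "'a set \<Rightarrow> 'e set \<Rightarrow> real \<Rightarrow> real \<Rightarrow> ('a \<times> 'e \<Rightarrow> real) \<Rightarrow> ereal" where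
  "Delta_d2 A E M \<epsilon> P =
     (INF Q\<in>{Q. dist_on E Q}. INF P'\<in>{P'. subdist_on (A \<times> E) P'}.
        ereal (2 * l1_dist (A \<times> E) P P')
        + ereal (sqrt \<epsilon> * M powr (1/2)) * ereal_exp (ereal (- (1/2)) * H2 A E P' Q))"

text \<open>
  The bound \<open>l1_dist (A \<times> E) P P' \<le> 1/2\<close> is the usual range of validity of the continuity estimate
  for the entropy with error term \<open>eta\<close>. If the infimum ranges over all \<open>P'\<close> with
  \<open>marginal A P' \<le> marginal A P\<close>, it is not an upper bound for \<open>I'\<close>: let \<open>E\<close> be a singleton, let \<open>P\<close>
  be a point mass, so that \<open>I' = ln M\<close>, and let \<open>P' = u P\<close>. Then the expression below is
  \<open>(1 - u) ln M - (1 - u) ln (1 - u) + \<epsilon> M u\<^sup>2 = ln M - u (ln M - 1) + O(u\<^sup>2)\<close>, which is smaller than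
  \<open>ln M\<close> if \<open>M \<ge> 3\<close> and \<open>u > 0\<close> is small.
\<close>

definition Delta_I2 ::
  "'a set \<Rightarrow> 'e set \<Rightarrow> real \<Rightarrow> real \<Rightarrow> ('a \<times> 'e \<Rightarrow> real) \<Rightarrow> ereal" where
  "Delta_I2 A E M \<epsilon> P =
     (INF P'\<in>{P'. subdist_on (A \<times> E) P' \<and> (\<forall>e\<in>E. marginal A P' e \<le> marginal A P e)
                  \<and> l1_dist (A \<times> E) P P' \<le> 1/2}.
        ereal (eta (l1_dist (A \<times> E) P P') (ln M))
        + ereal (\<epsilon> * M) * ereal_exp (- H2 A E P' (marginal A P)))"

definition kernel_code :: "nat \<Rightarrow> nat \<Rightarrow> ('k::field Matrix.vec \<Rightarrow> 'k Matrix.vec) \<Rightarrow> 'k Matrix.vec set"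
  where "kernel_code N m f = {v \<in> carrier_vec N. f v = 0\<^sub>v m}"

definition code_dim :: "nat \<Rightarrow> 'k::field Matrix.vec set \<Rightarrow> nat" where
  "code_dim N C = vectorspace.dim class_ring ((module_vec TYPE('k) N)\<lparr>carrier := C\<rparr>)"

definition dual_code :: "nat \<Rightarrow> 'k::field Matrix.vec set \<Rightarrow> 'k Matrix.vec set" where
  "dual_code N C = {y \<in> carrier_vec N. \<forall>z\<in>C. scalar_prod y z = 0}"

text \<open>The values of the random variable with distribution \<open>X\<close> are the elements of \<open>set_pmf X\<close>.\<close>

definition linear_hash ::
  "nat \<Rightarrow> nat \<Rightarrow> 'x pmf \<Rightarrow> ('x \<Rightarrow> 'k::field Matrix.vec \<Rightarrow> 'k Matrix.vec) \<Rightarrow> bool" where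
  "linear_hash N m X f \<longleftrightarrow>
     (\<forall>x\<in>set_pmf X. linear_map class_ring (module_vec TYPE('k) N) (module_vec TYPE('k) m) (f x))"

definition almost_dual_universal2 ::
  "nat \<Rightarrow> nat \<Rightarrow> real \<Rightarrow> 'x pmf \<Rightarrow> ('x \<Rightarrow> 'k::{field,finite} Matrix.vec \<Rightarrow> 'k Matrix.vec) \<Rightarrow> bool"
  where
  "almost_dual_universal2 N m \<epsilon> X f \<longleftrightarrow>
     Min ((\<lambda>x. code_dim N (kernel_code N m (f x))) ` set_pmf X) = N - m \<and>
     (\<forall>y \<in> carrier_vec N - {0\<^sub>v N}.
        measure_pmf.prob X {x. y \<in> dual_code N (kernel_code N m (f x))}
          \<le> \<epsilon> * real CARD('k) powi (int m - int N))"

end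

theory Submission
  imports Defs
begin

text \<open>
  Everything rests on one variance bound: for every real function \<open>g\<close> on the source space, the
  expected sum over \<open>b\<close> of the squared deviation of the fibre sum of \<open>g\<close> over \<open>b\<close> from its mean is
  at most \<open>\<epsilon> \<Sum> g\<^sup>2\<close>. For a syndrome \<open>y\<close> let the excess of \<open>y\<close> be the weight \<open>g a g a'\<close> of the
  pairs with \<open>y \<bullet> a = y \<bullet> a'\<close>, minus the fraction \<open>1 / q\<close> of the weight of all pairs; it is
  nonnegative by Cauchy-Schwarz. The adjoint of \<open>f\<^sub>x\<close> is injective and maps into the dual code, so the
  deviation of \<open>f\<^sub>x\<close> is bounded by the total excess of the nonzero words of the dual code. Taking the
  expectation turns this into \<open>\<epsilon> q\<^bsup>m-N\<^esup>\<close> times the total excess of the whole space.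

  The bounds on \<open>d1'\<close> then follow from Cauchy-Schwarz and the triangle inequality, the logarithmic
  bound on \<open>I'\<close> from Jensen's inequality. For the smoothed bound let \<open>\<delta> \<le> 1/2\<close> be the distance of \<open>P\<close>
  and \<open>P'\<close>. The part of the hashed \<open>P\<close> that is not below the hashed \<open>P'\<close> costs at most
  \<open>\<delta> ln M\<close>, since the density of \<open>P\<close> against the ideal distribution is at most \<open>M\<close>; two applications
  of Jensen's inequality to the common part, rescaled to mass \<open>1 - \<delta>\<close>, give
  \<open>- (1 - \<delta>) ln (1 - \<delta>) \<le> - \<delta> ln \<delta>\<close> plus the collision term. A bound through the continuity of
  the entropy alone would fail: the slack between the collision term and the entropy of \<open>P'\<close> is needed.
\<close>

subsection \<open>Entropy estimates\<close>

text \<open>Jensen's inequality for \<open>ln\<close> with unnormalised weights: the tangent of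
  \<open>ln\<close> at the weighted mean \<open>c\<close> is summed against \<open>w\<close>.
  Positivity of \<open>t\<close> is asked only on the support of \<open>w\<close>, so that quotients
  can be used whose denominators vanish elsewhere.\<close>

lemma sum_mult_ln_le:
  fixes w t :: "'i \<Rightarrow> real"
  assumes "finite I" and w: "\<And>i. i \<in> I \<Longrightarrow> 0 \<le> w i"
    and t: "\<And>i. i \<in> I \<Longrightarrow> 0 < w i \<Longrightarrow> 0 < t i" and pos: "0 < sum w I"
  shows "(\<Sum>i\<in>I. w i * ln (t i)) \<le> sum w I * ln ((\<Sum>i\<in>I. w i * t i) / sum w I)"
proof -
  define c where "c = (\<Sum>i\<in>I. w i * t i) / sum w I"
  obtain j where j: "j \<in> I" "0 < w j"
    using pos by (meson not_le sum_nonpos)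
  have nn: "0 \<le> w i * t i" if "i \<in> I" for i
    using w[OF that] t[OF that] by (cases "w i = 0") auto
  have "0 < (\<Sum>i\<in>I. w i * t i)"
    using j t \<open>finite I\<close> nn by (intro sum_pos2[of I j]) auto
  then have c: "0 < c" using pos by (simp add: c_def)
  have "w i * ln (t i) \<le> w i * (ln c - 1) + w i * t i / c" if "i \<in> I" for i
  proof (cases "w i = 0")
    case False
    then have "0 < w i" "0 < t i" using w t that by (auto simp: order.strict_iff_order)
    then have "ln (t i) \<le> ln c - 1 + t i / c"
      using ln_le_minus_one[of "t i / c"] c by (simp add: ln_div)
    then have "w i * ln (t i) \<le> w i * (ln c - 1 + t i / c)"
      using \<open>0 < w i\<close> by (intro mult_left_mono) auto
    then show ?thesis by (simp add: algebra_simps)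
  qed simp
  then have "(\<Sum>i\<in>I. w i * ln (t i)) \<le> (\<Sum>i\<in>I. w i * (ln c - 1) + w i * t i / c)"
    by (rule sum_mono)
  also have "\<dots> = sum w I * (ln c - 1) + (\<Sum>i\<in>I. w i * t i) / c"
    by (simp add: sum.distrib sum_distrib_right sum_divide_distrib)
  also have "(\<Sum>i\<in>I. w i * t i) / c = sum w I"
    using c pos by (simp add: c_def field_simps)
  finally show ?thesis by (simp add: c_def algebra_simps)
qed

text \<open>Concavity of \<open>ln\<close>: \<open>1 - x\<close> is the convex combination of \<open>x\<close> and 1 with weight \<open>x / (1 - x)\<close>
  on \<open>x\<close>.\<close>

lemma entropy_term_reflect:
  fixes x :: real
  assumes "0 \<le> x" "x \<le> 1/2"
  shows "x * ln x \<le> (1 - x) * ln (1 - x)"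
proof (cases "x = 0")
  case False
  then have x: "0 < x" "0 < 1 - x" using assms by auto
  have "x * ln (x / (1 - x)) \<le> x * (x / (1 - x) - 1)"
    using x by (intro mult_left_mono ln_le_minus_one) auto
  moreover have "(1 - 2 * x) * ln (1 / (1 - x)) \<le> (1 - 2 * x) * (1 / (1 - x) - 1)"
    using x assms by (intro mult_left_mono ln_le_minus_one) auto
  moreover have "x * (x / (1 - x) - 1) + (1 - 2 * x) * (1 / (1 - x) - 1) = 0"
    using x by (simp add: field_simps)
  ultimately have "x * ln (x / (1 - x)) + (1 - 2 * x) * ln (1 / (1 - x)) \<le> 0" by linarith
  then show ?thesis using x by (simp add: ln_div algebra_simps)
qed simp

text \<open>\<open>g\<close> is cut into a part \<open>w\<close> of mass \<open>1 - \<delta>\<close>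
  below both \<open>g\<close> and \<open>h\<close>, and a rest of mass \<open>\<delta>\<close>. The
  rest is charged at \<open>ln M\<close>; on \<open>w\<close> the logarithm splits as
  \<open>ln (w / r) + ln (g / w)\<close>, and each summand is estimated by Jensen's inequality. In
  \<open>chi\<close> the second moment is compared with the mass of \<open>h\<close>, which may
  differ from 1.\<close>

lemma relative_entropy_le:
  fixes g h r :: "'i \<Rightarrow> real"
  assumes "finite I"
    and g: "\<And>i. i \<in> I \<Longrightarrow> 0 \<le> g i" and h: "\<And>i. i \<in> I \<Longrightarrow> 0 \<le> h i" and r: "\<And>i. i \<in> I \<Longrightarrow> 0 \<le> r i"
    and le: "\<And>i. i \<in> I \<Longrightarrow> g i \<le> M * r i"
    and sum_g: "sum g I = 1"
    and dist: "(\<Sum>i\<in>I. \<bar>g i - h i\<bar>) \<le> \<delta>" and "\<delta> < 1"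
    and chi: "(\<Sum>i\<in>I. (h i)\<^sup>2 / r i) \<le> sum h I + Y" and "0 \<le> Y"
  shows "(\<Sum>i\<in>I. g i * ln (g i / r i)) \<le> \<delta> * ln M - (1 - \<delta>) * ln (1 - \<delta>) + Y"
proof -
  define z where "z = 1 - \<delta>"
  define y where "y = (\<Sum>i\<in>I. min (g i) (h i))"
  define s where "s = sum h I"
  \<comment> \<open>The factor \<open>z / y\<close>, at most 1, brings the overlap down to mass
    exactly \<open>1 - \<delta>\<close>, so that the rest \<open>g - w\<close> has mass exactly
    \<open>\<delta>\<close>.\<close>
  define w where "w i = z / y * min (g i) (h i)" for i
  have z: "0 < z" "1 - z = \<delta>" using \<open>\<delta> < 1\<close> by (auto simp: z_def)
  \<comment> \<open>Pointwise, twice the minimum plus the absolute difference is the sum; this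
    bounds the overlap \<open>y\<close> from below by the distance.\<close>
  have "2 * y + (\<Sum>i\<in>I. \<bar>g i - h i\<bar>) = sum g I + sum h I"
    unfolding y_def sum_distrib_left sum.distrib[symmetric] by (rule sum.cong) (auto simp: min_def)
  then have y2: "1 + s - \<delta> \<le> 2 * y" using dist sum_g by (simp add: s_def)
  have "y \<le> sum g I" "y \<le> s" by (auto simp: y_def s_def intro: sum_mono)
  then have y: "z \<le> y" "0 < y" "y \<le> 1" "y \<le> s" using y2 sum_g z by (auto simp: z_def)
  \<comment> \<open>\<open>z \<le> y - t\<close> and \<open>s = y + t\<close> for the mass \<open>t\<close> of the part of \<open>h\<close> that exceeds \<open>g\<close>.\<close>
  have zs: "z * s \<le> y\<^sup>2"
  proof -
    have "z * s \<le> (2 * y - s) * s" using y2 y by (intro mult_right_mono) (auto simp: z_def)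
    also have "\<dots> \<le> y\<^sup>2" using sum_squares_ge_zero[of "y - s" 0]
      by (simp add: power2_eq_square algebra_simps)
    finally show ?thesis .
  qed
  have w_nn: "0 \<le> w i" if "i \<in> I" for i using g h that z y by (simp add: w_def)
  have w_le: "w i \<le> g i" if "i \<in> I" for i
  proof -
    have "w i \<le> 1 * min (g i) (h i)"
      unfolding w_def using g h that z y by (intro mult_right_mono) auto
    then show ?thesis by simp
  qed
  have sum_w: "sum w I = z"
    unfolding w_def sum_distrib_left[symmetric] y_def[symmetric] using y by simp
  \<comment> \<open>\<open>g i \<le> M * r i\<close> rules out \<open>r i = 0\<close> where
    \<open>g i\<close> is positive.\<close>
  have pos: "0 < g i \<and> 0 < r i" if "i \<in> I" "0 < w i" for i
    using that w_le[of i] le[of i] r[of i] by (cases "r i = 0") auto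
  have "g i * ln (g i / r i) \<le> (g i - w i) * ln M + w i * ln (w i / r i) + w i * ln (g i / w i)"
    if i: "i \<in> I" for i
  proof -
    have "(g i - w i) * ln (g i / r i) \<le> (g i - w i) * ln M"
    proof (cases "g i = 0")
      case True
      then show ?thesis using w_nn[OF i] w_le[OF i] by simp
    next
      case False
      then have "0 < g i" "0 < r i" using g[OF i] le[OF i] r[OF i] by (cases "r i = 0"; auto)+
      then show ?thesis using w_le[OF i] le[OF i]
        by (intro mult_left_mono ln_mono) (auto simp: pos_divide_le_eq)
    qed
    moreover have "w i * ln (g i / r i) = w i * ln (w i / r i) + w i * ln (g i / w i)"
    proof (cases "w i = 0")
      case False
      then have "0 < w i" using w_nn[OF i] by simp
      then show ?thesis using pos[OF i] by (simp add: ln_div algebra_simps)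
    qed simp
    ultimately show ?thesis by (simp add: algebra_simps)
  qed
  then have "(\<Sum>i\<in>I. g i * ln (g i / r i))
      \<le> (\<Sum>i\<in>I. (g i - w i) * ln M + w i * ln (w i / r i) + w i * ln (g i / w i))"
    by (rule sum_mono)
  also have "\<dots> = \<delta> * ln M + (\<Sum>i\<in>I. w i * ln (w i / r i)) + (\<Sum>i\<in>I. w i * ln (g i / w i))"
    by (simp add: sum.distrib sum_distrib_right[symmetric] sum_subtractf sum_g sum_w z)
  \<comment> \<open>The Jensen bound is factored so as to expose \<open>z * s / y^2\<close>, which
    is at most 1 by \<open>zs\<close>; what remains is \<open>1 + Y / s\<close>.\<close>
  also have "(\<Sum>i\<in>I. w i * ln (w i / r i)) \<le> z * ln ((1 + Y / s) * (z / s) * (s / y)\<^sup>2)"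
  proof -
    have "(\<Sum>i\<in>I. w i * ln (w i / r i)) \<le> z * ln ((\<Sum>i\<in>I. w i * (w i / r i)) / z)"
      using sum_mult_ln_le[of I w "\<lambda>i. w i / r i"] \<open>finite I\<close> w_nn pos sum_w z by simp
    also have "\<dots> \<le> z * ln ((1 + Y / s) * (z / s) * (s / y)\<^sup>2)"
    proof (intro mult_left_mono ln_mono)
      have "(\<Sum>i\<in>I. w i * (w i / r i)) \<le> (\<Sum>i\<in>I. (z / y)\<^sup>2 * ((h i)\<^sup>2 / r i))"
      proof (rule sum_mono)
        fix i assume i: "i \<in> I"
        have "w i * (w i / r i) = (z / y)\<^sup>2 * ((min (g i) (h i))\<^sup>2 / r i)"
          by (simp add: w_def power2_eq_square mult_ac)
        also have "\<dots> \<le> (z / y)\<^sup>2 * ((h i)\<^sup>2 / r i)"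
          using g[OF i] h[OF i] r[OF i]
          by (intro mult_left_mono divide_right_mono power_mono) auto
        finally show "w i * (w i / r i) \<le> (z / y)\<^sup>2 * ((h i)\<^sup>2 / r i)" .
      qed
      also have "\<dots> \<le> (z / y)\<^sup>2 * (s + Y)"
        unfolding sum_distrib_left[symmetric] using chi by (intro mult_left_mono) (auto simp: s_def)
      finally have "(\<Sum>i\<in>I. w i * (w i / r i)) / z \<le> (z / y)\<^sup>2 * (s + Y) / z"
        using z by (intro divide_right_mono) auto
      also have "\<dots> = (1 + Y / s) * (z / s) * (s / y)\<^sup>2"
        using z y by (simp add: power2_eq_square field_simps)
      finally show "(\<Sum>i\<in>I. w i * (w i / r i)) / z \<le> (1 + Y / s) * (z / s) * (s / y)\<^sup>2" .
      obtain j where j: "j \<in> I" "0 < w j"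
        using sum_w z by (metis not_le sum_nonpos)
      have "0 < (\<Sum>i\<in>I. w i * (w i / r i))"
        using j \<open>finite I\<close> pos w_nn r by (intro sum_pos2[of I j]) auto
      then show "0 < (\<Sum>i\<in>I. w i * (w i / r i)) / z" using z by simp
    qed (use z in simp)
    finally show ?thesis .
  qed
  \<comment> \<open>Here Jensen's inequality yields the mass of \<open>g\<close> on the support of
    \<open>w\<close>, divided by \<open>z\<close>; terms with \<open>w i = 0\<close> vanish.\<close>
  also have "(\<Sum>i\<in>I. w i * ln (g i / w i)) \<le> z * ln (1 / z)"
  proof -
    have "(\<Sum>i\<in>I. w i * ln (g i / w i)) \<le> z * ln ((\<Sum>i\<in>I. w i * (g i / w i)) / z)"
      using sum_mult_ln_le[of I w "\<lambda>i. g i / w i"] \<open>finite I\<close> w_nn pos sum_w z by simp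
    also have "\<dots> \<le> z * ln (1 / z)"
    proof (intro mult_left_mono ln_mono divide_right_mono)
      have le': "w i * (g i / w i) \<le> g i" "0 \<le> w i * (g i / w i)" if "i \<in> I" for i using g[OF that] by auto
      then show "(\<Sum>i\<in>I. w i * (g i / w i)) \<le> 1"
        unfolding sum_g[symmetric] by (intro sum_mono)
      obtain j where j: "j \<in> I" "0 < w j"
        using sum_w z by (metis not_le sum_nonpos)
      have "0 < (\<Sum>i\<in>I. w i * (g i / w i))"
        using j \<open>finite I\<close> pos[OF j] le' by (intro sum_pos2[of I j]) auto
      then show "0 < (\<Sum>i\<in>I. w i * (g i / w i)) / z" using z by simp
    qed (use z in auto)
    finally show ?thesis .
  qed
  also have "z * ln ((1 + Y / s) * (z / s) * (s / y)\<^sup>2) \<le> Y"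
  proof -
    have "(z / s) * (s / y)\<^sup>2 \<le> 1"
      using zs y by (simp add: power2_eq_square field_simps)
    then have "(1 + Y / s) * ((z / s) * (s / y)\<^sup>2) \<le> (1 + Y / s) * 1"
      using \<open>0 \<le> Y\<close> y by (intro mult_left_mono) auto
    moreover have "0 < 1 + Y / s" "0 < z / s" "0 < s / y"
      using \<open>0 \<le> Y\<close> y z by (auto intro: add_pos_nonneg)
    then have "0 < (1 + Y / s) * (z / s) * (s / y)\<^sup>2" by (intro mult_pos_pos zero_less_power)
    ultimately have "ln ((1 + Y / s) * (z / s) * (s / y)\<^sup>2) \<le> ln (1 + Y / s)"
      by (intro ln_mono) (simp_all only: mult.assoc mult_1_right)
    also have "\<dots> \<le> Y / s" using \<open>0 \<le> Y\<close> y by (intro ln_add_one_self_le_self) auto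
    finally have "z * ln ((1 + Y / s) * (z / s) * (s / y)\<^sup>2) \<le> z * (Y / s)"
      using z by (intro mult_left_mono) auto
    \<comment> \<open>From \<open>z \<le> y\<close> and \<open>y \<le> s\<close> the factor
      \<open>z / s\<close> is at most 1.\<close>
    also have "\<dots> \<le> Y" using \<open>0 \<le> Y\<close> y z mult_right_mono[of z s Y] by (simp add: field_simps)
    finally show ?thesis .
  qed
  finally show ?thesis using z by (simp add: ln_div z_def)
qed

subsection \<open>The variance of a linear hash function\<close>

lemma finite_carrier_vec_finite: "finite (carrier_vec n :: 'k::finite Matrix.vec set)"
  and card_carrier_vec_finite: "card (carrier_vec n :: 'k::finite Matrix.vec set) = CARD('k) ^ n"
proof -
  let ?L = "{xs :: 'k list. set xs \<subseteq> UNIV \<and> length xs = n}"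
  have bij: "bij_betw vec_of_list ?L (carrier_vec n)"
    by (rule bij_betwI[where g = list_of_vec]) (auto simp: list_vec vec_list intro: carrier_vecI)
  have "finite ?L" by (rule finite_lists_length_eq) simp
  then show "finite (carrier_vec n :: 'k Matrix.vec set)"
    using bij bij_betw_finite by blast
  show "card (carrier_vec n :: 'k Matrix.vec set) = CARD('k) ^ n"
    using bij_betw_same_card[OF bij] card_lists_length_eq[of "UNIV :: 'k set" n] by simp
qed

text \<open>Induction on the number of leading coordinates of \<open>v\<close> that are kept; each
  step adds a multiple of one unit vector.\<close>

lemma linear_functional_scalar_prod:
  fixes L :: "'k::field Matrix.vec \<Rightarrow> 'k"
  assumes add: "\<And>u v. u \<in> carrier_vec N \<Longrightarrow> v \<in> carrier_vec N \<Longrightarrow> L (u + v) = L u + L v"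
    and smult: "\<And>c v. v \<in> carrier_vec N \<Longrightarrow> L (c \<cdot>\<^sub>v v) = c * L v"
    and v: "v \<in> carrier_vec N"
  shows "L v = scalar_prod (Matrix.vec N (\<lambda>j. L (unit_vec N j))) v"
proof -
  have "L (Matrix.vec N (\<lambda>j. if j < n then vec_index v j else 0)) = (\<Sum>j<n. L (unit_vec N j) * vec_index v j)" if "n \<le> N" for n
    using that
  proof (induction n)
    case 0
    have "Matrix.vec N (\<lambda>j. if j < 0 then vec_index v j else 0) = 0 \<cdot>\<^sub>v v" using v by auto
    then show ?case using smult[OF v, of 0] by simp
  next
    case (Suc n)
    have "Matrix.vec N (\<lambda>j. if j < Suc n then vec_index v j else 0)
        = Matrix.vec N (\<lambda>j. if j < n then vec_index v j else 0) + (vec_index v n) \<cdot>\<^sub>v unit_vec N n"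
      using Suc.prems by (intro eq_vecI) (auto simp: less_Suc_eq unit_vec_def)
    then show ?case using Suc by (simp add: add smult mult.commute)
  qed
  from this[of N] have "L (Matrix.vec N (\<lambda>j. if j < N then vec_index v j else 0)) = (\<Sum>j<N. L (unit_vec N j) * vec_index v j)"
    by simp
  moreover have "Matrix.vec N (\<lambda>j. if j < N then vec_index v j else 0) = v" using v by auto
  ultimately show ?thesis using v by (simp add: scalar_prod_def lessThan_atLeast0)
qed

text \<open>Translation by a suitable multiple of a unit vector at which \<open>u\<close> has a
  nonzero coordinate maps any level set of the functional injectively into any other. Hence the
  \<open>q\<close> level sets have equal size.\<close>

lemma card_scalar_prod_eq:
  fixes u :: "'k::{field,finite} Matrix.vec"
  assumes u: "u \<in> carrier_vec m" and "u \<noteq> 0\<^sub>v m"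
  shows "real (card {w \<in> carrier_vec m. scalar_prod w u = s}) = real (CARD('k) ^ m) / real CARD('k)"
proof -
  obtain i where i: "i < m" "vec_index u i \<noteq> 0"
    using assms by (metis carrier_vecD eq_vecI index_zero_vec(1) index_zero_vec(2))
  let ?H = "\<lambda>s. {w \<in> carrier_vec m. scalar_prod w u = s}"
  have fin: "finite (?H s)" for s
    using finite_carrier_vec_finite[of m, where ?'k = 'k] by auto
  define e where "e t = (t / vec_index u i) \<cdot>\<^sub>v unit_vec m i" for t
  have e: "e t \<in> carrier_vec m" "scalar_prod (e t) u = t" for t
    using u i by (auto simp: e_def)
  have le: "card (?H s) \<le> card (?H t)" for s t
  proof (rule card_inj_on_le)
    show "inj_on (\<lambda>w. w + e (t - s)) (?H s)"
    proof (rule inj_onI)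
      fix x y assume xy: "x \<in> ?H s" "y \<in> ?H s" "x + e (t - s) = y + e (t - s)"
      have "vec_index x j = vec_index y j" if "j < m" for j
        using arg_cong[OF xy(3), of "\<lambda>w. vec_index w j"] xy(1,2) e(1)[of "t - s"] that by auto
      then show "x = y" using xy(1,2) by (intro eq_vecI) auto
    qed
    show "(\<lambda>w. w + e (t - s)) ` ?H s \<subseteq> ?H t"
      using u e by (auto simp: add_scalar_prod_distrib[OF _ e(1) u])
  qed (rule fin)
  have "CARD('k) ^ m = card (\<Union>t\<in>UNIV. ?H t)"
    unfolding card_carrier_vec_finite[symmetric] by (rule arg_cong[where f = card]) auto
  also have "\<dots> = (\<Sum>t\<in>UNIV. card (?H t))"
    by (rule card_UN_disjoint) (use fin in auto)
  also have "\<dots> = (\<Sum>t\<in>(UNIV :: 'k set). card (?H s))"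
    by (rule sum.cong) (use le in \<open>auto intro: antisym\<close>)
  finally have "real (CARD('k) ^ m) = real CARD('k) * real (card (?H s))" by simp
  then show ?thesis by simp
qed

section \<open>Weighted collisions of syndromes\<close>

text \<open>For a nontrivial additive character this is \<open>1 / q\<close> times the sum, over
  nonzero scalars \<open>t\<close>, of the squared modulus of the Fourier transform of
  \<open>g\<close> at \<open>t y\<close>. It is also the sum of the squared deviations of the
  \<open>q\<close> fibre sums of \<open>g\<close> from their mean.\<close>

definition collision_excess :: "nat \<Rightarrow> ('k::{field,finite} Matrix.vec \<Rightarrow> real) \<Rightarrow> 'k Matrix.vec \<Rightarrow> real" where
  "collision_excess N g y = (\<Sum>a\<in>carrier_vec N. \<Sum>a'\<in>carrier_vec N.
     g a * g a' * (of_bool (scalar_prod y a = scalar_prod y a') - 1 / real CARD('k)))"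

text \<open>Squaring a fibre sum produces exactly the pairs with equal image. It is applied with
  \<open>h\<close> a scalar product, for syndromes, and with \<open>h\<close> the hash
  function.\<close>

lemma sum_fibre_power2:
  fixes g :: "'a \<Rightarrow> real"
  assumes "finite A" "finite S" "h ` A \<subseteq> S"
  shows "(\<Sum>s\<in>S. (\<Sum>a\<in>{a\<in>A. h a = s}. g a)\<^sup>2)
    = (\<Sum>a\<in>A. \<Sum>a'\<in>A. g a * g a' * of_bool (h a = h a'))"
proof -
  have "(\<Sum>s\<in>S. (\<Sum>a\<in>{a\<in>A. h a = s}. g a)\<^sup>2)
      = (\<Sum>s\<in>S. \<Sum>a\<in>{a\<in>A. h a = s}. g a * (\<Sum>a'\<in>{a'\<in>A. h a = h a'}. g a'))"
    by (intro sum.cong refl) (auto simp: power2_eq_square sum_distrib_right intro!: sum.cong arg_cong2[where f = "(*)"])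
  also have "\<dots> = (\<Sum>a\<in>A. g a * (\<Sum>a'\<in>{a'\<in>A. h a = h a'}. g a'))"
    using assms by (rule sum.group)
  also have "\<dots> = (\<Sum>a\<in>A. \<Sum>a'\<in>A. g a * g a' * of_bool (h a = h a'))"
    using \<open>finite A\<close>
    by (intro sum.cong refl) (simp add: sum_distrib_left sum.inter_filter of_bool_def if_distrib cong: if_cong)
  finally show ?thesis .
qed

lemma one_less_card_field: "1 < CARD('k::{field,finite})"
  using card_mono[of UNIV "{0, 1 :: 'k}"] by simp

text \<open>Cauchy-Schwarz for the \<open>q\<close> fibre sums. The sign allows sums over syndromes
  to be enlarged and a probability bound to be inserted under the sum.\<close>

lemma collision_excess_nonneg:
  fixes y :: "'k::{field,finite} Matrix.vec"
  shows "0 \<le> collision_excess N g y"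
proof -
  let ?V = "carrier_vec N :: 'k Matrix.vec set" and ?q = "real CARD('k)"
  let ?G = "\<lambda>s. \<Sum>a\<in>{a\<in>?V. scalar_prod y a = s}. g a"
  note fin = finite_carrier_vec_finite[of N, where ?'k = 'k]
  have "(\<Sum>s\<in>UNIV. ?G s) = sum g ?V"
    by (rule sum.group) (use fin in auto)
  moreover have "(\<Sum>s\<in>UNIV. 1 * ?G s)\<^sup>2 \<le> (\<Sum>s\<in>(UNIV :: 'k set). 1\<^sup>2) * (\<Sum>s\<in>UNIV. (?G s)\<^sup>2)"
    by (rule Cauchy_Schwarz_ineq_sum)
  moreover have "(\<Sum>s\<in>UNIV. (?G s)\<^sup>2)
      = (\<Sum>a\<in>?V. \<Sum>a'\<in>?V. g a * g a' * of_bool (scalar_prod y a = scalar_prod y a'))"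
    by (rule sum_fibre_power2) (use fin in auto)
  ultimately have "(sum g ?V)\<^sup>2 / ?q
      \<le> (\<Sum>a\<in>?V. \<Sum>a'\<in>?V. g a * g a' * of_bool (scalar_prod y a = scalar_prod y a'))"
    by (simp add: divide_le_eq mult.commute)
  moreover have "collision_excess N g y
      = (\<Sum>a\<in>?V. \<Sum>a'\<in>?V. g a * g a' * of_bool (scalar_prod y a = scalar_prod y a')) - (sum g ?V)\<^sup>2 / ?q"
    unfolding collision_excess_def power2_eq_square sum_product
    by (simp add: right_diff_distrib sum_subtractf sum_divide_distrib)
  ultimately show ?thesis by simp
qed

text \<open>Summing over all syndromes separates the points of the target space; this takes the place of
  the orthogonality of additive characters.\<close>

lemma sum_collision_excess:
  fixes f :: "'k::{field,finite} Matrix.vec \<Rightarrow> 'k Matrix.vec"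
  assumes f: "\<And>a. a \<in> carrier_vec N \<Longrightarrow> f a \<in> carrier_vec m"
    and adj: "\<And>w a. w \<in> carrier_vec m \<Longrightarrow> a \<in> carrier_vec N \<Longrightarrow> scalar_prod (adj w) a = scalar_prod w (f a)"
  shows "(\<Sum>w\<in>carrier_vec m. collision_excess N g (adj w))
    = real (CARD('k) ^ m) * (1 - 1 / real CARD('k))
      * (\<Sum>b\<in>carrier_vec m. (\<Sum>a\<in>{a\<in>carrier_vec N. f a = b}. g a)\<^sup>2)"
proof -
  let ?V = "carrier_vec N :: 'k Matrix.vec set" and ?W = "carrier_vec m :: 'k Matrix.vec set"
  let ?q = "real CARD('k)"
  note finN = finite_carrier_vec_finite[of N, where ?'k = 'k]
  note finm = finite_carrier_vec_finite[of m, where ?'k = 'k]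
  \<comment> \<open>If the hash values agree, every \<open>w\<close> contributes
    \<open>1 - 1 / q\<close>. Otherwise the syndromes agree for exactly the share
    \<open>1 / q\<close> of all \<open>w\<close>, which the subtracted \<open>1 / q\<close>
    cancels.\<close>
  have sum_w: "(\<Sum>w\<in>?W. of_bool (scalar_prod (adj w) a = scalar_prod (adj w) a') - 1 / ?q)
      = real (CARD('k) ^ m) * (1 - 1 / ?q) * of_bool (f a = f a')" if a: "a \<in> ?V" "a' \<in> ?V" for a a'
  proof (cases "f a = f a'")
    case True
    then have "(\<Sum>w\<in>?W. of_bool (scalar_prod (adj w) a = scalar_prod (adj w) a') - 1 / ?q) = (\<Sum>w\<in>?W. 1 - 1 / ?q)"
      by (intro sum.cong refl) (simp add: adj a)
    then show ?thesis using True by (simp add: card_carrier_vec_finite)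
  next
    case False
    have u: "f a - f a' \<in> ?W" using f a by auto
    moreover have "f a - f a' \<noteq> 0\<^sub>v m"
    proof
      assume eq: "f a - f a' = 0\<^sub>v m"
      have "vec_index (f a) i = vec_index (f a') i" if "i < m" for i
        using arg_cong[OF eq, of "\<lambda>v. vec_index v i"] that f[OF a(1)] f[OF a(2)] by simp
      then have "f a = f a'" using f[OF a(1)] f[OF a(2)] by (intro eq_vecI) auto
      then show False using False by simp
    qed
    ultimately have "real (card {w \<in> ?W. scalar_prod w (f a - f a') = 0}) = real (CARD('k) ^ m) / ?q"
      by (rule card_scalar_prod_eq)
    moreover have "(\<Sum>w\<in>?W. of_bool (scalar_prod (adj w) a = scalar_prod (adj w) a'))
        = (\<Sum>w\<in>?W. of_bool (scalar_prod w (f a - f a') = 0) :: real)"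
      using f a by (intro sum.cong refl) (simp add: adj scalar_prod_minus_distrib)
    moreover have "(\<Sum>w\<in>?W. of_bool (scalar_prod w (f a - f a') = 0) :: real)
        = real (card {w \<in> ?W. scalar_prod w (f a - f a') = 0})"
      using finm by (simp add: sum.If_cases of_bool_def Collect_conj_eq Int_commute)
    ultimately show ?thesis using False by (simp add: sum_subtractf card_carrier_vec_finite)
  qed
  have *: "(\<Sum>w\<in>?W. g a * g a' * (of_bool (scalar_prod (adj w) a = scalar_prod (adj w) a') - 1 / ?q))
      = real (CARD('k) ^ m) * (1 - 1 / ?q) * (g a * g a' * of_bool (f a = f a'))"
    if "a \<in> ?V" "a' \<in> ?V" for a a'
    by (subst sum_distrib_left[symmetric], subst sum_w[OF that]) (simp only: mult_ac)
  have "(\<Sum>w\<in>?W. collision_excess N g (adj w))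
      = (\<Sum>a\<in>?V. \<Sum>a'\<in>?V. \<Sum>w\<in>?W.
          g a * g a' * (of_bool (scalar_prod (adj w) a = scalar_prod (adj w) a') - 1 / ?q))"
    unfolding collision_excess_def
    by (subst sum.swap) (rule sum.cong[OF refl], rule sum.swap)
  also have "\<dots> = real (CARD('k) ^ m) * (1 - 1 / ?q) * (\<Sum>a\<in>?V. \<Sum>a'\<in>?V. g a * g a' * of_bool (f a = f a'))"
    unfolding sum_distrib_left by (intro sum.cong refl *)
  also have "(\<Sum>a\<in>?V. \<Sum>a'\<in>?V. g a * g a' * of_bool (f a = f a'))
      = (\<Sum>b\<in>?W. (\<Sum>a\<in>{a\<in>?V. f a = b}. g a)\<^sup>2)"
    by (rule sum_fibre_power2[symmetric]) (use finN finm f in auto)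
  finally show ?thesis .
qed

section \<open>The variance of one hash function and its expectation\<close>

lemma sum_power2_deviation:
  fixes F :: "'b \<Rightarrow> real"
  assumes "finite B" "B \<noteq> {}"
  shows "(\<Sum>b\<in>B. (F b - sum F B / real (card B))\<^sup>2) = (\<Sum>b\<in>B. (F b)\<^sup>2) - (sum F B)\<^sup>2 / real (card B)"
proof -
  define c where "c = sum F B / real (card B)"
  have c: "sum F B = c * real (card B)" using assms by (simp add: c_def)
  have "(\<Sum>b\<in>B. (F b - c)\<^sup>2) = (\<Sum>b\<in>B. (F b)\<^sup>2 - 2 * c * F b + c\<^sup>2)"
    by (intro sum.cong refl) (simp add: power2_eq_square algebra_simps)
  also have "\<dots> = (\<Sum>b\<in>B. (F b)\<^sup>2) - 2 * c * sum F B + real (card B) * c\<^sup>2"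
    by (simp add: sum.distrib sum_subtractf sum_distrib_left)
  also have "\<dots> = (\<Sum>b\<in>B. (F b)\<^sup>2) - (sum F B)\<^sup>2 / real (card B)"
    unfolding c using assms by (simp add: power2_eq_square field_simps)
  finally show ?thesis by (simp add: c_def)
qed

text \<open>\<open>adj w\<close> is the transposed matrix of \<open>f\<close> applied to
  \<open>w\<close>: its coordinates are the products of \<open>w\<close> with the images of the unit
  vectors.\<close>

lemma linear_map_adjoint:
  fixes f :: "'k::field Matrix.vec \<Rightarrow> 'k Matrix.vec"
  assumes lin: "linear_map class_ring (module_vec TYPE('k) N) (module_vec TYPE('k) m) f"
  obtains adj where "\<And>w. adj w \<in> carrier_vec N"
    and "\<And>w a. w \<in> carrier_vec m \<Longrightarrow> a \<in> carrier_vec N \<Longrightarrow> scalar_prod (adj w) a = scalar_prod w (f a)"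
    and "\<And>a. a \<in> carrier_vec N \<Longrightarrow> f a \<in> carrier_vec m"
proof -
  have hom: "f \<in> LinearCombinations.module_hom class_ring (module_vec TYPE('k) N) (module_vec TYPE('k) m)"
    using lin by (simp add: linear_map_def mod_hom_def mod_hom_axioms_def)
  have f: "f a \<in> carrier_vec m" if "a \<in> carrier_vec N" for a
    using hom that by (auto simp: LinearCombinations.module_hom_def module_vec_simps)
  have add: "f (u + v) = f u + f v" if "u \<in> carrier_vec N" "v \<in> carrier_vec N" for u v
    using hom that by (auto simp: LinearCombinations.module_hom_def module_vec_simps)
  have smult: "f (c \<cdot>\<^sub>v v) = c \<cdot>\<^sub>v f v" if "v \<in> carrier_vec N" for c v
    using hom that by (auto simp: LinearCombinations.module_hom_def module_vec_simps)
  have *: "scalar_prod w (f a) = scalar_prod (Matrix.vec N (\<lambda>j. scalar_prod w (f (unit_vec N j)))) a"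
    if w: "w \<in> carrier_vec m" and a: "a \<in> carrier_vec N" for w a
    using a by (rule linear_functional_scalar_prod[of N "\<lambda>a. scalar_prod w (f a)", rotated 2])
      (use w f in \<open>simp_all add: add smult scalar_prod_add_distrib[of w m]\<close>)
  show ?thesis
    by (rule that[of "\<lambda>w. Matrix.vec N (\<lambda>j. scalar_prod w (f (unit_vec N j)))"])
      (simp_all only: vec_carrier f *[symmetric])
qed

text \<open>In the sum of the excess over all \<open>adj w\<close>, the term of \<open>w = 0\<close>
  is exactly what subtracting the mean removes. The other \<open>adj w\<close> are distinct nonzero
  words of the dual code, because surjectivity of \<open>f\<close> makes the adjoint
  injective.\<close>

lemma power2_deviation_hash_le:
  fixes f :: "'k::{field,finite} Matrix.vec \<Rightarrow> 'k Matrix.vec"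
  assumes lin: "linear_map class_ring (module_vec TYPE('k) N) (module_vec TYPE('k) m) f"
    and surj: "f ` carrier_vec N = carrier_vec m"
  shows "real (CARD('k) ^ m) * (1 - 1 / real CARD('k))
      * (\<Sum>b\<in>carrier_vec m. ((\<Sum>a\<in>{a\<in>carrier_vec N. f a = b}. g a)
          - sum g (carrier_vec N) / real (CARD('k) ^ m))\<^sup>2)
    \<le> sum (collision_excess N g) (dual_code N (kernel_code N m f) - {0\<^sub>v N})"
proof -
  let ?V = "carrier_vec N :: 'k Matrix.vec set" and ?W = "carrier_vec m :: 'k Matrix.vec set"
  let ?q = "real CARD('k)" and ?D = "dual_code N (kernel_code N m f) - {0\<^sub>v N}"
  let ?F = "\<lambda>b. \<Sum>a\<in>{a\<in>?V. f a = b}. g a"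
  note finN = finite_carrier_vec_finite[of N, where ?'k = 'k]
  note finm = finite_carrier_vec_finite[of m, where ?'k = 'k]
  obtain adj where adj: "\<And>w. adj w \<in> ?V"
    "\<And>w a. w \<in> ?W \<Longrightarrow> a \<in> ?V \<Longrightarrow> scalar_prod (adj w) a = scalar_prod w (f a)"
    and f: "\<And>a. a \<in> ?V \<Longrightarrow> f a \<in> ?W"
    by (rule linear_map_adjoint[OF lin]) blast
  \<comment> \<open>Coordinate \<open>i\<close> of \<open>w\<close> is read off by pairing
    \<open>adj w\<close> with a preimage of the unit vector \<open>i\<close>.\<close>
  have inj: "w = w'" if w: "w \<in> ?W" "w' \<in> ?W" and eq: "adj w = adj w'" for w w'
  proof (rule eq_vecI)
    fix i assume "i < dim_vec w'"
    then have i: "i < m" using w by simp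
    then obtain a where a: "a \<in> ?V" "f a = unit_vec m i"
      using surj by (metis imageE unit_vec_carrier)
    then show "vec_index w i = vec_index w' i"
      using adj(2)[OF w(1) a(1)] adj(2)[OF w(2) a(1)] eq w i by simp
  qed (use w in simp)
  have adj0: "scalar_prod (adj (0\<^sub>v m)) a = 0" if "a \<in> ?V" for a
    using adj(2)[OF _ that, of "0\<^sub>v m"] f[OF that] by simp
  have adj_0: "adj (0\<^sub>v m) = 0\<^sub>v N"
  proof (rule eq_vecI)
    fix i assume "i < dim_vec (0\<^sub>v N :: 'k Matrix.vec)"
    then show "vec_index (adj (0\<^sub>v m)) i = vec_index (0\<^sub>v N) i"
      using adj0[of "unit_vec N i"] adj(1)[of "0\<^sub>v m"] by simp
  qed (use adj(1)[of "0\<^sub>v m"] in simp)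
  \<comment> \<open>At the zero syndrome all pairs collide, so each has weight
    \<open>1 - 1 / q\<close>.\<close>
  have excess_0: "collision_excess N g (adj (0\<^sub>v m)) = (1 - 1 / ?q) * (sum g ?V)\<^sup>2"
    unfolding collision_excess_def power2_eq_square sum_product
    unfolding sum_distrib_left
    by (intro sum.cong refl) (simp add: adj0 mult_ac)
  have sub: "adj ` (?W - {0\<^sub>v m}) \<subseteq> ?D"
  proof
    fix y assume "y \<in> adj ` (?W - {0\<^sub>v m})"
    then obtain w where w: "w \<in> ?W" "w \<noteq> 0\<^sub>v m" "y = adj w" by auto
    then have "y \<noteq> 0\<^sub>v N" using inj[of w "0\<^sub>v m"] adj_0 by auto
    then show "y \<in> ?D" using w adj by (auto simp: dual_code_def kernel_code_def)
  qed
  have "real (CARD('k) ^ m) * (1 - 1 / ?q) * (\<Sum>b\<in>?W. (?F b)\<^sup>2) = (\<Sum>w\<in>?W. collision_excess N g (adj w))"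
    by (rule sum_collision_excess[symmetric]) (use f adj in auto)
  also have "\<dots> = (1 - 1 / ?q) * (sum g ?V)\<^sup>2 + (\<Sum>w\<in>?W - {0\<^sub>v m}. collision_excess N g (adj w))"
    using finm by (subst sum.remove[of _ "0\<^sub>v m"]) (auto simp: excess_0)
  also have "(\<Sum>w\<in>?W - {0\<^sub>v m}. collision_excess N g (adj w))
      = sum (collision_excess N g) (adj ` (?W - {0\<^sub>v m}))"
    by (rule sum.reindex_cong[symmetric, of adj]) (auto intro!: inj_onI inj)
  also have "\<dots> \<le> sum (collision_excess N g) ?D"
    using sub finN by (intro sum_mono2) (auto simp: dual_code_def collision_excess_nonneg)
  finally have le: "real (CARD('k) ^ m) * (1 - 1 / ?q) * (\<Sum>b\<in>?W. (?F b)\<^sup>2)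
      \<le> (1 - 1 / ?q) * (sum g ?V)\<^sup>2 + sum (collision_excess N g) ?D" by simp
  have ne: "?W \<noteq> {}" using zero_carrier_vec[of m] by blast
  have "sum ?F ?W = sum g ?V"
    by (rule sum.group) (use finN finm f in auto)
  then have "(\<Sum>b\<in>?W. (?F b - sum g ?V / real (CARD('k) ^ m))\<^sup>2)
      = (\<Sum>b\<in>?W. (?F b)\<^sup>2) - (sum g ?V)\<^sup>2 / real (CARD('k) ^ m)"
    using sum_power2_deviation[OF finm ne, of ?F] by (simp only: card_carrier_vec_finite)
  moreover have "real (CARD('k) ^ m) * (1 - 1 / ?q) * ((\<Sum>b\<in>?W. (?F b)\<^sup>2) - (sum g ?V)\<^sup>2 / real (CARD('k) ^ m))
      = real (CARD('k) ^ m) * (1 - 1 / ?q) * (\<Sum>b\<in>?W. (?F b)\<^sup>2) - (1 - 1 / ?q) * (sum g ?V)\<^sup>2"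
    unfolding right_diff_distrib[of "real (CARD('k) ^ m) * (1 - 1 / ?q)"] by simp
  ultimately show ?thesis using le by simp
qed

text \<open>The excess identity is used twice: behind the bound for each \<open>f x\<close>, and for
  the identity map of the source space, whose fibres are singletons. The factor
  \<open>1 - 1 / q\<close> is common to both sides, and the power \<open>m - N\<close> of
  \<open>q\<close> from universality meets the power \<open>N\<close> from the identity map.\<close>

lemma expectation_power2_deviation_hash_le:
  fixes f :: "'x \<Rightarrow> 'k::{field,finite} Matrix.vec \<Rightarrow> 'k Matrix.vec"
  assumes fin: "finite (set_pmf X)" and lin: "linear_hash N m X f"
    and surj: "\<And>x. x \<in> set_pmf X \<Longrightarrow> f x ` carrier_vec N = carrier_vec m"
    and univ: "almost_dual_universal2 N m \<epsilon> X f" and "0 \<le> \<epsilon>"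
  shows "(\<Sum>x\<in>set_pmf X. pmf X x *
      (\<Sum>b\<in>carrier_vec m. ((\<Sum>a\<in>{a\<in>carrier_vec N. f x a = b}. g a)
          - sum g (carrier_vec N) / real (CARD('k) ^ m))\<^sup>2))
    \<le> \<epsilon> * (\<Sum>a\<in>carrier_vec N. (g a)\<^sup>2)"
proof -
  let ?V = "carrier_vec N :: 'k Matrix.vec set" and ?W = "carrier_vec m :: 'k Matrix.vec set"
  let ?q = "real CARD('k)" and ?D = "\<lambda>x. dual_code N (kernel_code N m (f x))"
  let ?S = "\<lambda>x. \<Sum>b\<in>?W. ((\<Sum>a\<in>{a\<in>?V. f x a = b}. g a) - sum g ?V / real (CARD('k) ^ m))\<^sup>2"
  let ?c = "real (CARD('k) ^ m) * (1 - 1 / ?q)"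
  note finN = finite_carrier_vec_finite[of N, where ?'k = 'k]
  have q: "1 < ?q" using one_less_card_field[where ?'k = 'k] by simp
  then have c: "0 < ?c" by simp
  have "?c * (\<Sum>x\<in>set_pmf X. pmf X x * ?S x) = (\<Sum>x\<in>set_pmf X. pmf X x * (?c * ?S x))"
    by (simp add: sum_distrib_left mult_ac)
  also have "\<dots> \<le> (\<Sum>x\<in>set_pmf X. pmf X x * sum (collision_excess N g) (?D x - {0\<^sub>v N}))"
    using lin surj by (intro sum_mono mult_left_mono power2_deviation_hash_le) (auto simp: linear_hash_def)
  also have "\<dots> = (\<Sum>x\<in>set_pmf X. \<Sum>y\<in>?V - {0\<^sub>v N}. pmf X x * of_bool (y \<in> ?D x) * collision_excess N g y)"
  proof (intro sum.cong refl)
    fix x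
    have "sum (collision_excess N g) (?D x - {0\<^sub>v N})
        = (\<Sum>y\<in>?V - {0\<^sub>v N}. of_bool (y \<in> ?D x) * collision_excess N g y)"
      by (rule sum.mono_neutral_cong_left) (use finN in \<open>auto simp: dual_code_def\<close>)
    then show "pmf X x * sum (collision_excess N g) (?D x - {0\<^sub>v N})
        = (\<Sum>y\<in>?V - {0\<^sub>v N}. pmf X x * of_bool (y \<in> ?D x) * collision_excess N g y)"
      by (simp add: sum_distrib_left mult.assoc)
  qed
  also have "\<dots> = (\<Sum>y\<in>?V - {0\<^sub>v N}. measure_pmf.prob X {x. y \<in> ?D x} * collision_excess N g y)"
  proof (subst sum.swap, intro sum.cong refl)
    fix y
    have "measure_pmf.prob X {x. y \<in> ?D x} = measure_pmf.expectation X (indicator {x. y \<in> ?D x})"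
      by simp
    also have "\<dots> = (\<Sum>x\<in>set_pmf X. indicator {x. y \<in> ?D x} x * pmf X x)"
      by (rule integral_measure_pmf_real[OF fin]) simp
    also have "\<dots> = (\<Sum>x\<in>set_pmf X. pmf X x * of_bool (y \<in> ?D x))"
      by (intro sum.cong refl) (simp add: indicator_def mult.commute)
    finally show "(\<Sum>x\<in>set_pmf X. pmf X x * of_bool (y \<in> ?D x) * collision_excess N g y)
        = measure_pmf.prob X {x. y \<in> ?D x} * collision_excess N g y"
      by (simp add: sum_distrib_right)
  qed
  also have "\<dots> \<le> (\<Sum>y\<in>?V - {0\<^sub>v N}. \<epsilon> * ?q powi (int m - int N) * collision_excess N g y)"
    using univ
    by (intro sum_mono mult_right_mono) (auto simp: almost_dual_universal2_def collision_excess_nonneg)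
  \<comment> \<open>Universality says nothing about the zero syndrome; it is added back to complete
    the sum, its excess being nonnegative.\<close>
  also have "\<dots> \<le> (\<Sum>y\<in>?V. \<epsilon> * ?q powi (int m - int N) * collision_excess N g y)"
    using finN q \<open>0 \<le> \<epsilon>\<close> by (intro sum_mono2) (auto simp: collision_excess_nonneg)
  also have "\<dots> = \<epsilon> * ?q powi (int m - int N) * (\<Sum>y\<in>?V. collision_excess N g y)"
    by (simp add: sum_distrib_left)
  also have "(\<Sum>y\<in>?V. collision_excess N g y)
      = real (CARD('k) ^ N) * (1 - 1 / ?q) * (\<Sum>b\<in>?V. (\<Sum>a\<in>{a\<in>?V. a = b}. g a)\<^sup>2)"
    by (rule sum_collision_excess[of N "\<lambda>a. a" N "\<lambda>y. y"]) auto
  also have "(\<Sum>b\<in>?V. (\<Sum>a\<in>{a\<in>?V. a = b}. g a)\<^sup>2) = (\<Sum>b\<in>?V. (g b)\<^sup>2)"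
  proof (intro sum.cong refl)
    fix b assume "b \<in> ?V"
    then have "{a \<in> ?V. a = b} = {b}" by auto
    then show "(\<Sum>a\<in>{a\<in>?V. a = b}. g a)\<^sup>2 = (g b)\<^sup>2" by simp
  qed
  also have "\<epsilon> * ?q powi (int m - int N) * (real (CARD('k) ^ N) * (1 - 1 / ?q) * (\<Sum>b\<in>?V. (g b)\<^sup>2))
      = ?c * (\<epsilon> * (\<Sum>a\<in>?V. (g a)\<^sup>2))"
  proof -
    have "?q powi (int m - int N) * real (CARD('k) ^ N) = real (CARD('k) ^ m)"
      using q by (simp add: power_int_diff)
    moreover have "\<epsilon> * A * (B * C * D) = A * B * C * (\<epsilon> * D)" for A B C D :: real
      by (simp only: mult_ac)
    ultimately show ?thesis by simp
  qed
  finally show ?thesis by (simp only: mult_le_cancel_left_pos[OF c])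
qed

subsection \<open>Security bounds from the variance bound\<close>

lemma sum_cartesian_triple:
  "(\<Sum>x\<in>A. \<Sum>b\<in>B. \<Sum>e\<in>C. F x b e) = (\<Sum>(x, b, e)\<in>A \<times> B \<times> C. F x b e)"
  by (simp add: sum.cartesian_product split_def)

lemma sum_l1_dist: "(\<Sum>e\<in>E. \<Sum>a\<in>A. \<bar>P (a, e) - P' (a, e)\<bar>) = l1_dist (A \<times> E) P P'"
  by (subst sum.swap) (simp add: l1_dist_def sum.cartesian_product split_def)

section \<open>Collision entropy as a real sum\<close>

text \<open>Under the support condition the only division by zero is \<open>0 / 0\<close>, which is
  0 both in \<open>real\<close> and in \<open>ereal\<close>.\<close>

lemma sum_ereal_divide:
  fixes P :: "'a \<times> 'e \<Rightarrow> real"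
  assumes "\<And>e. e \<in> E \<Longrightarrow> 0 \<le> Q e"
    and "\<And>a e. a \<in> A \<Longrightarrow> e \<in> E \<Longrightarrow> Q e = 0 \<Longrightarrow> P (a, e) = 0"
  shows "(\<Sum>a\<in>A. \<Sum>e\<in>E. ereal ((P (a, e))\<^sup>2) / ereal (Q e)) = ereal (\<Sum>a\<in>A. \<Sum>e\<in>E. (P (a, e))\<^sup>2 / Q e)"
proof -
  have "ereal ((P (a, e))\<^sup>2) / ereal (Q e) = ereal ((P (a, e))\<^sup>2 / Q e)" if "a \<in> A" "e \<in> E" for a e
    using assms(2)[OF that] by (cases "Q e = 0") auto
  then show ?thesis by simp
qed

lemma sum_ereal_divide_eq_PInf:
  fixes P :: "'a \<times> 'e \<Rightarrow> real"
  assumes "finite A" "finite E" "a \<in> A" "e \<in> E" "Q e = 0" "P (a, e) \<noteq> 0"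
  shows "(\<Sum>a\<in>A. \<Sum>e\<in>E. ereal ((P (a, e))\<^sup>2) / ereal (Q e)) = \<infinity>"
proof -
  have "ereal ((P (a, e))\<^sup>2) / ereal (Q e) = \<infinity>" using assms by simp
  then have "(\<Sum>e\<in>E. ereal ((P (a, e))\<^sup>2) / ereal (Q e)) = \<infinity>"
    using assms by (subst sum_Pinfty) blast
  then show ?thesis using assms by (subst sum_Pinfty) blast
qed

lemma H2_eq_ereal_ln:
  assumes "\<And>e. e \<in> E \<Longrightarrow> 0 \<le> Q e"
    and "\<And>a e. a \<in> A \<Longrightarrow> e \<in> E \<Longrightarrow> Q e = 0 \<Longrightarrow> P (a, e) = 0"
  shows "H2 A E P Q = - ereal_ln (ereal (\<Sum>a\<in>A. \<Sum>e\<in>E. (P (a, e))\<^sup>2 / Q e))"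
  unfolding H2_def by (simp only: sum_ereal_divide[of E Q A P, OF assms])

lemma ereal_exp_uminus_H2:
  assumes "\<And>e. e \<in> E \<Longrightarrow> 0 \<le> Q e"
    and "\<And>a e. a \<in> A \<Longrightarrow> e \<in> E \<Longrightarrow> Q e = 0 \<Longrightarrow> P (a, e) = 0"
  shows "ereal_exp (- H2 A E P Q) = ereal (\<Sum>a\<in>A. \<Sum>e\<in>E. (P (a, e))\<^sup>2 / Q e)"
proof -
  have "0 \<le> (\<Sum>a\<in>A. \<Sum>e\<in>E. (P (a, e))\<^sup>2 / Q e)"
    using assms(1) by (intro sum_nonneg) auto
  then show ?thesis
    by (auto simp: H2_eq_ereal_ln[of E Q A P, OF assms] ereal_ln_def ereal_exp_def)
qed

lemma ereal_exp_half_H2: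
  assumes "\<And>e. e \<in> E \<Longrightarrow> 0 \<le> Q e"
    and "\<And>a e. a \<in> A \<Longrightarrow> e \<in> E \<Longrightarrow> Q e = 0 \<Longrightarrow> P (a, e) = 0"
  shows "ereal_exp (ereal (- (1/2)) * H2 A E P Q) = ereal (sqrt (\<Sum>a\<in>A. \<Sum>e\<in>E. (P (a, e))\<^sup>2 / Q e))"
proof -
  define s where "s = (\<Sum>a\<in>A. \<Sum>e\<in>E. (P (a, e))\<^sup>2 / Q e)"
  have "0 \<le> s" unfolding s_def using assms(1) by (intro sum_nonneg) auto
  moreover have H2: "H2 A E P Q = - ereal_ln (ereal s)"
    unfolding s_def by (intro H2_eq_ereal_ln assms)
  moreover have "exp (ln s / 2) = sqrt s" if "0 < s"
    using that by (simp add: ln_sqrt[symmetric])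
  \<comment> \<open>For \<open>s = 0\<close> the entropy is \<open>\<infinity>\<close> and both
    sides are 0.\<close>
  ultimately show ?thesis
    unfolding H2 s_def[symmetric] by (cases "s = 0") (auto simp: ereal_ln_def ereal_exp_def)
qed

lemma ereal_exp_half_H2_eq_PInf:
  assumes "finite A" "finite E" "a \<in> A" "e \<in> E" "Q e = 0" "P (a, e) \<noteq> 0"
  shows "ereal_exp (ereal (- (1/2)) * H2 A E P Q) = \<infinity>"
  using sum_ereal_divide_eq_PInf[of A E a e Q P] assms
  by (simp add: H2_def ereal_ln_def ereal_exp_def)

section \<open>Marginals and hashed distributions\<close>

lemma marginal_nonneg:
  "(\<And>a. a \<in> A \<Longrightarrow> 0 \<le> P (a, e)) \<Longrightarrow> 0 \<le> marginal A P e"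
  by (simp add: marginal_def sum_nonneg)

lemma push_nonneg:
  "(\<And>a. a \<in> A \<Longrightarrow> 0 \<le> P (a, e)) \<Longrightarrow> 0 \<le> push f A P (b, e)"
  by (auto simp: push_def intro: sum_nonneg)

lemma push_le_marginal:
  "finite A \<Longrightarrow> (\<And>a. a \<in> A \<Longrightarrow> 0 \<le> P (a, e)) \<Longrightarrow> push f A P (b, e) \<le> marginal A P e"
  unfolding push_def marginal_def prod.case by (rule sum_mono2) auto

lemma sum_push:
  "finite A \<Longrightarrow> finite B \<Longrightarrow> f ` A \<subseteq> B \<Longrightarrow> (\<Sum>b\<in>B. push f A P (b, e)) = marginal A P e"
  unfolding push_def marginal_def prod.case by (rule sum.group)

lemma sum_marginal: "(\<Sum>e\<in>E. marginal A P e) = sum P (A \<times> E)"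
  unfolding marginal_def by (subst sum.swap) (simp add: sum.cartesian_product split_def)

text \<open>Data processing: the triangle inequality holds in each fibre, and pushing the pointwise
  absolute difference forward preserves its total mass.\<close>

lemma sum_abs_push_diff_le:
  fixes P P' :: "'a \<times> 'e \<Rightarrow> real"
  assumes "finite A" "finite B" "f ` A \<subseteq> B"
  shows "(\<Sum>b\<in>B. \<Sum>e\<in>E. \<bar>push f A P (b, e) - push f A P' (b, e)\<bar>) \<le> l1_dist (A \<times> E) P P'"
proof -
  let ?R = "\<lambda>(a, e). \<bar>P (a, e) - P' (a, e)\<bar>"
  have "(\<Sum>b\<in>B. \<Sum>e\<in>E. \<bar>push f A P (b, e) - push f A P' (b, e)\<bar>)
      \<le> (\<Sum>b\<in>B. \<Sum>e\<in>E. push f A ?R (b, e))"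
    unfolding push_def prod.case sum_subtractf[symmetric] by (intro sum_mono sum_abs)
  also have "\<dots> = (\<Sum>e\<in>E. marginal A ?R e)"
    by (subst sum.swap) (simp add: sum_push assms)
  also have "\<dots> = l1_dist (A \<times> E) P P'"
    by (simp add: sum_marginal l1_dist_def split_def)
  finally show ?thesis .
qed

text \<open>The factor 2 has two sources: the hashed distributions, and the marginals, whose
  \<open>M\<close> copies each carry the weight \<open>1 / M\<close>.\<close>

lemma d1'_le_l1_dist:
  fixes P P' :: "'a \<times> 'e \<Rightarrow> real"
  assumes "finite A" "finite B" "B \<noteq> {}" "f ` A \<subseteq> B"
  shows "d1' A E B f P \<le> d1' A E B f P' + 2 * l1_dist (A \<times> E) P P'"
proof -
  let ?M = "real (card B)"
  have M: "0 < ?M" using assms by (simp add: card_gt_0_iff)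
  have "\<bar>push f A P (b, e) - marginal A P e / ?M\<bar>
      \<le> \<bar>push f A P' (b, e) - marginal A P' e / ?M\<bar> + \<bar>push f A P (b, e) - push f A P' (b, e)\<bar>
        + \<bar>marginal A P e - marginal A P' e\<bar> / ?M" for b e
  proof -
    have "\<bar>marginal A P e - marginal A P' e\<bar> / ?M = \<bar>marginal A P e / ?M - marginal A P' e / ?M\<bar>"
      using M by (simp add: diff_divide_distrib[symmetric] abs_divide)
    then show ?thesis by linarith
  qed
  then have "d1' A E B f P \<le> (\<Sum>b\<in>B. \<Sum>e\<in>E.
      \<bar>push f A P' (b, e) - marginal A P' e / ?M\<bar> + \<bar>push f A P (b, e) - push f A P' (b, e)\<bar>
        + \<bar>marginal A P e - marginal A P' e\<bar> / ?M)"
    unfolding d1'_def by (intro sum_mono) blast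
  also have "\<dots> = d1' A E B f P' + (\<Sum>b\<in>B. \<Sum>e\<in>E. \<bar>push f A P (b, e) - push f A P' (b, e)\<bar>)
      + (\<Sum>e\<in>E. \<bar>marginal A P e - marginal A P' e\<bar>)"
    using M by (simp add: d1'_def sum.distrib sum_divide_distrib[symmetric])
  also have "(\<Sum>e\<in>E. \<bar>marginal A P e - marginal A P' e\<bar>) \<le> l1_dist (A \<times> E) P P'"
    unfolding sum_l1_dist[symmetric] marginal_def sum_subtractf[symmetric] by (intro sum_mono sum_abs)
  finally show ?thesis
    using sum_abs_push_diff_le[where P = P and P' = P' and E = E, OF assms(1,2,4)] by linarith
qed

section \<open>Hash families with small variance: the L1 criterion\<close>

text \<open>The interface between coding theory and information theory: codes enter the bounds only
  through \<open>variance_le\<close>. It is stated for every real function \<open>g\<close>, so that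
  it applies to each slice of \<open>P\<close> at a fixed \<open>e\<close>.\<close>

locale small_variance_hash =
  fixes A :: "'a set" and B :: "'b set" and X :: "'x pmf" and f :: "'x \<Rightarrow> 'a \<Rightarrow> 'b" and \<epsilon> :: real
  assumes finite_A: "finite A" and finite_B: "finite B" and B_ne: "B \<noteq> {}"
    and finite_X: "finite (set_pmf X)" and \<epsilon>_nonneg: "0 \<le> \<epsilon>"
    and f_into: "\<And>x. x \<in> set_pmf X \<Longrightarrow> f x ` A \<subseteq> B"
    and variance_le: "\<And>g. (\<Sum>x\<in>set_pmf X. pmf X x *
        (\<Sum>b\<in>B. ((\<Sum>a\<in>{a\<in>A. f x a = b}. g a) - sum g A / real (card B))\<^sup>2)) \<le> \<epsilon> * (\<Sum>a\<in>A. (g a)\<^sup>2)"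
begin

abbreviation "M \<equiv> real (card B)"

lemma M_pos: "0 < M"
  using finite_B B_ne by (simp add: card_gt_0_iff)

lemma expectation_eq:
  fixes F :: "'x \<Rightarrow> real"
  shows "measure_pmf.expectation X F = (\<Sum>x\<in>set_pmf X. pmf X x * F x)"
  using integral_measure_pmf[OF finite_X, of X F] by simp

lemma sum_pmf_mult: "(\<Sum>x\<in>set_pmf X. pmf X x * c) = c"
  using sum_pmf_eq_1[OF finite_X, of X] by (simp add: sum_distrib_right[symmetric])

lemma variance_push_le:
  "(\<Sum>x\<in>set_pmf X. pmf X x * (\<Sum>b\<in>B. (push (f x) A P (b, e) - marginal A P e / M)\<^sup>2))
    \<le> \<epsilon> * (\<Sum>a\<in>A. (P (a, e))\<^sup>2)"
  using variance_le[of "\<lambda>a. P (a, e)"] by (simp add: push_def marginal_def)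

text \<open>Cauchy-Schwarz over the triples \<open>(x, b, e)\<close> with weights
  \<open>pmf X x * Q e\<close>: the weights sum to \<open>M\<close>, and the other factor is a
  variance divided by \<open>Q e\<close>.\<close>

lemma expectation_d1'_le:
  assumes Q: "dist_on E Q"
    and ac: "\<And>a e. a \<in> A \<Longrightarrow> e \<in> E \<Longrightarrow> Q e = 0 \<Longrightarrow> P (a, e) = 0"
  shows "measure_pmf.expectation X (\<lambda>x. d1' A E B (f x) P)
    \<le> sqrt \<epsilon> * sqrt M * sqrt (\<Sum>a\<in>A. \<Sum>e\<in>E. (P (a, e))\<^sup>2 / Q e)"
proof -
  define D where "D x b e = push (f x) A P (b, e) - marginal A P e / M" for x b e
  let ?I = "set_pmf X \<times> B \<times> E"
  let ?u = "\<lambda>(x, b, e). sqrt (pmf X x * Q e)"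
  let ?v = "\<lambda>(x, b, e). sqrt (pmf X x / Q e) * \<bar>D x b e\<bar>"
  have Q0: "0 \<le> Q e" if "e \<in> E" for e using Q that by (simp add: dist_on_def)
  \<comment> \<open>The deviation vanishes wherever \<open>Q\<close> does, so splitting off the
    weight loses nothing there.\<close>
  have D0: "D x b e = 0" if "e \<in> E" "Q e = 0" for x b e
    using ac[OF _ that] by (simp add: D_def push_def marginal_def)
  have "measure_pmf.expectation X (\<lambda>x. d1' A E B (f x) P)
      = (\<Sum>x\<in>set_pmf X. \<Sum>b\<in>B. \<Sum>e\<in>E. pmf X x * \<bar>D x b e\<bar>)"
    by (simp add: expectation_eq d1'_def D_def sum_distrib_left)
  also have "\<dots> = (\<Sum>i\<in>?I. ?u i * ?v i)"
    unfolding sum_cartesian_triple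
  proof (intro sum.cong refl, clarify)
    fix x b e assume e: "e \<in> E"
    show "pmf X x * \<bar>D x b e\<bar> = sqrt (pmf X x * Q e) * (sqrt (pmf X x / Q e) * \<bar>D x b e\<bar>)"
    proof (cases "Q e = 0")
      case False
      have "sqrt (pmf X x * Q e) * sqrt (pmf X x / Q e) = pmf X x"
        using False by (simp add: real_sqrt_mult[symmetric] del: real_sqrt_divide real_sqrt_mult)
      then show ?thesis by (simp only: mult.assoc[symmetric])
    qed (simp add: D0 e)
  qed
  also have "\<dots> \<le> sqrt ((\<Sum>i\<in>?I. (?u i)\<^sup>2) * (\<Sum>i\<in>?I. (?v i)\<^sup>2))"
    using Cauchy_Schwarz_ineq_sum[of ?u ?v ?I] by (rule real_le_rsqrt)
  also have "\<dots> \<le> sqrt (M * (\<epsilon> * (\<Sum>a\<in>A. \<Sum>e\<in>E. (P (a, e))\<^sup>2 / Q e)))"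
  proof (intro real_sqrt_le_mono mult_mono)
    have "(\<Sum>i\<in>?I. (?u i)\<^sup>2) = (\<Sum>x\<in>set_pmf X. \<Sum>b\<in>B. \<Sum>e\<in>E. pmf X x * Q e)"
      unfolding sum_cartesian_triple using Q0 by (intro sum.cong refl) auto
    also have "\<dots> = (\<Sum>x\<in>set_pmf X. pmf X x * M)"
      using Q by (simp add: sum_distrib_left[symmetric] dist_on_def mult.commute[of M])
    also have "\<dots> = M" by (rule sum_pmf_mult)
    finally show "(\<Sum>i\<in>?I. (?u i)\<^sup>2) \<le> M" by simp
    have "(\<Sum>i\<in>?I. (?v i)\<^sup>2) = (\<Sum>x\<in>set_pmf X. \<Sum>b\<in>B. \<Sum>e\<in>E. pmf X x * (D x b e)\<^sup>2 / Q e)"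
      unfolding sum_cartesian_triple using Q0
      by (intro sum.cong refl) (auto simp: power_mult_distrib)
    \<comment> \<open>The sum over \<open>e\<close> moves outside because the variance bound holds
      for each slice separately.\<close>
    also have "\<dots> = (\<Sum>e\<in>E. (\<Sum>x\<in>set_pmf X. pmf X x * (\<Sum>b\<in>B. (D x b e)\<^sup>2)) / Q e)"
      unfolding sum_distrib_left sum_divide_distrib
      by (subst (3) sum.swap, subst (2) sum.swap) (simp add: sum.swap[of _ B])
    also have "\<dots> \<le> (\<Sum>e\<in>E. \<epsilon> * (\<Sum>a\<in>A. (P (a, e))\<^sup>2) / Q e)"
      unfolding D_def using Q0 by (intro sum_mono divide_right_mono variance_push_le)
    also have "\<dots> = \<epsilon> * (\<Sum>a\<in>A. \<Sum>e\<in>E. (P (a, e))\<^sup>2 / Q e)"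
      by (subst sum.swap) (simp add: sum_distrib_left sum_divide_distrib)
    finally show "(\<Sum>i\<in>?I. (?v i)\<^sup>2) \<le> \<epsilon> * (\<Sum>a\<in>A. \<Sum>e\<in>E. (P (a, e))\<^sup>2 / Q e)" .
  qed (auto intro: sum_nonneg)
  finally show ?thesis by (simp add: real_sqrt_mult mult_ac)
qed

text \<open>With variance 0 every fibre sum equals its mean. This serves the case of entropy
  \<open>-\<infinity>\<close>, where the claimed bound reads
  \<open>0 * \<infinity> = 0\<close>.\<close>

lemma expectation_d1'_eq_0:
  assumes "\<epsilon> = 0"
  shows "measure_pmf.expectation X (\<lambda>x. d1' A E B (f x) P) = 0"
proof -
  have "push (f x) A P (b, e) - marginal A P e / M = 0" if "x \<in> set_pmf X" "b \<in> B" for x b e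
  proof -
    let ?S = "\<lambda>x. \<Sum>b\<in>B. (push (f x) A P (b, e) - marginal A P e / M)\<^sup>2"
    have nn: "0 \<le> pmf X x * ?S x" for x by (intro mult_nonneg_nonneg sum_nonneg) auto
    have "(\<Sum>x\<in>set_pmf X. pmf X x * ?S x) = 0"
      using variance_push_le[of P e] assms nn by (intro antisym sum_nonneg) auto
    then have "pmf X x * ?S x = 0"
      using that finite_X nn by (simp only: sum_nonneg_eq_0_iff)
    then have "?S x = 0" using that by (simp add: set_pmf_iff)
    then show ?thesis using that finite_B by (simp add: sum_nonneg_eq_0_iff)
  qed
  then show ?thesis by (simp add: expectation_eq d1'_def)
qed

lemma expectation_d1'_le_H2:
  assumes "finite E" and Q: "dist_on E Q"
  shows "ereal (measure_pmf.expectation X (\<lambda>x. d1' A E B (f x) P))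
    \<le> ereal (sqrt \<epsilon> * M powr (1/2)) * ereal_exp (ereal (- (1/2)) * H2 A E P Q)"
proof (cases "\<forall>a\<in>A. \<forall>e\<in>E. Q e = 0 \<longrightarrow> P (a, e) = 0")
  case True
  then have "ereal_exp (ereal (- (1/2)) * H2 A E P Q) = ereal (sqrt (\<Sum>a\<in>A. \<Sum>e\<in>E. (P (a, e))\<^sup>2 / Q e))"
    using Q by (intro ereal_exp_half_H2) (auto simp: dist_on_def)
  then show ?thesis
    using expectation_d1'_le[OF Q, of P] True M_pos by (simp add: powr_half_sqrt)
next
  case False
  then obtain a e where "a \<in> A" "e \<in> E" "Q e = 0" "P (a, e) \<noteq> 0" by blast
  then have *: "ereal_exp (ereal (- (1/2)) * H2 A E P Q) = \<infinity>"
    using finite_A \<open>finite E\<close> by (intro ereal_exp_half_H2_eq_PInf)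
  show ?thesis
  proof (cases "\<epsilon> = 0")
    case True
    then show ?thesis using * by (simp add: expectation_d1'_eq_0)
  next
    case False
    then have "0 < sqrt \<epsilon> * M powr (1/2)" using \<epsilon>_nonneg M_pos by simp
    moreover have "ereal c * \<infinity> = \<infinity>" if "0 < c" for c using that by simp
    ultimately show ?thesis unfolding * by (simp only: ereal_less_eq)
  qed
qed

text \<open>For each \<open>Q\<close> and \<open>P'\<close> the passage from \<open>P\<close> to
  \<open>P'\<close> costs twice the distance, and the unsmoothed bound is applied to
  \<open>P'\<close>.\<close>

lemma expectation_d1'_le_Delta_d2:
  assumes "finite E"
  shows "ereal (measure_pmf.expectation X (\<lambda>x. d1' A E B (f x) P)) \<le> Delta_d2 A E M \<epsilon> P"
  unfolding Delta_d2_def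
proof (intro INF_greatest)
  fix Q P' assume "Q \<in> {Q. dist_on E Q}"
  then have Q: "dist_on E Q" by simp
  have "measure_pmf.expectation X (\<lambda>x. d1' A E B (f x) P)
      \<le> (\<Sum>x\<in>set_pmf X. pmf X x * (d1' A E B (f x) P' + 2 * l1_dist (A \<times> E) P P'))"
    unfolding expectation_eq using finite_A finite_B B_ne f_into
    by (intro sum_mono mult_left_mono d1'_le_l1_dist) auto
  also have "\<dots> = 2 * l1_dist (A \<times> E) P P' + measure_pmf.expectation X (\<lambda>x. d1' A E B (f x) P')"
    by (simp only: distrib_left sum.distrib sum_pmf_mult expectation_eq add.commute)
  finally have "ereal (measure_pmf.expectation X (\<lambda>x. d1' A E B (f x) P))
      \<le> ereal (2 * l1_dist (A \<times> E) P P') + ereal (measure_pmf.expectation X (\<lambda>x. d1' A E B (f x) P'))"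
    by simp
  also have "\<dots> \<le> ereal (2 * l1_dist (A \<times> E) P P')
      + ereal (sqrt \<epsilon> * M powr (1/2)) * ereal_exp (ereal (- (1/2)) * H2 A E P' Q)"
    by (intro add_left_mono expectation_d1'_le_H2 assms Q)
  finally show "ereal (measure_pmf.expectation X (\<lambda>x. d1' A E B (f x) P))
      \<le> ereal (2 * l1_dist (A \<times> E) P P')
      + ereal (sqrt \<epsilon> * M powr (1/2)) * ereal_exp (ereal (- (1/2)) * H2 A E P' Q)" .
qed

section \<open>The mutual information criterion\<close>

text \<open>The hash index is kept as a component, so that the expectation of \<open>I'\<close>
  becomes one relative entropy against \<open>ideal\<close>, in which the hash value is
  uniform.\<close>

definition joint :: "('a \<times> 'e \<Rightarrow> real) \<Rightarrow> 'x \<times> 'b \<times> 'e \<Rightarrow> real" where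
  "joint P = (\<lambda>(x, b, e). pmf X x * push (f x) A P (b, e))"

definition ideal :: "('e \<Rightarrow> real) \<Rightarrow> 'x \<times> 'b \<times> 'e \<Rightarrow> real" where
  "ideal R = (\<lambda>(x, b, e). pmf X x * R e / M)"

lemma sum_joint: "sum (joint P) (set_pmf X \<times> B \<times> E) = sum P (A \<times> E)"
proof -
  have "sum (joint P) (set_pmf X \<times> B \<times> E) = (\<Sum>x\<in>set_pmf X. pmf X x * (\<Sum>b\<in>B. \<Sum>e\<in>E. push (f x) A P (b, e)))"
    unfolding joint_def sum_cartesian_triple[symmetric] by (simp add: sum_distrib_left)
  also have "\<dots> = (\<Sum>x\<in>set_pmf X. pmf X x * (\<Sum>e\<in>E. marginal A P e))"
    by (intro sum.cong refl, subst sum.swap) (simp add: sum_push finite_A finite_B f_into)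
  finally show ?thesis by (simp add: sum_pmf_mult sum_marginal)
qed

lemma sum_abs_joint_diff_le:
  "(\<Sum>i\<in>set_pmf X \<times> B \<times> E. \<bar>joint P i - joint P' i\<bar>) \<le> l1_dist (A \<times> E) P P'"
proof -
  have "(\<Sum>i\<in>set_pmf X \<times> B \<times> E. \<bar>joint P i - joint P' i\<bar>)
      = (\<Sum>x\<in>set_pmf X. pmf X x * (\<Sum>b\<in>B. \<Sum>e\<in>E. \<bar>push (f x) A P (b, e) - push (f x) A P' (b, e)\<bar>))"
    unfolding sum_distrib_left sum_cartesian_triple joint_def
    by (intro sum.cong refl) (auto simp: right_diff_distrib[symmetric] abs_mult)
  also have "\<dots> \<le> (\<Sum>x\<in>set_pmf X. pmf X x * l1_dist (A \<times> E) P P')"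
    using finite_A finite_B f_into by (intro sum_mono mult_left_mono sum_abs_push_diff_le) auto
  finally show ?thesis by (simp add: sum_pmf_mult)
qed

text \<open>The sum of squares over \<open>b\<close> splits into the deviations, bounded on average
  by \<open>variance_le\<close>, and the squared mean, which gives the marginal term.
  \<open>R\<close> is kept apart from the marginal of \<open>P\<close> because smoothing measures
  \<open>P'\<close> against the marginal of \<open>P\<close>.\<close>

lemma sum_power2_joint_le:
  assumes R: "\<And>e. e \<in> E \<Longrightarrow> 0 \<le> R e"
  shows "(\<Sum>i\<in>set_pmf X \<times> B \<times> E. (joint P i)\<^sup>2 / ideal R i)
    \<le> (\<Sum>e\<in>E. (marginal A P e)\<^sup>2 / R e) + \<epsilon> * M * (\<Sum>a\<in>A. \<Sum>e\<in>E. (P (a, e))\<^sup>2 / R e)"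
proof -
  have push: "(\<Sum>b\<in>B. (push (f x) A P (b, e))\<^sup>2)
      = (\<Sum>b\<in>B. (push (f x) A P (b, e) - marginal A P e / M)\<^sup>2) + (marginal A P e)\<^sup>2 / M"
    if "x \<in> set_pmf X" for x e
    using sum_power2_deviation[OF finite_B B_ne, of "\<lambda>b. push (f x) A P (b, e)"]
      sum_push[OF finite_A finite_B f_into[OF that], of P e] by simp
  have "(\<Sum>i\<in>set_pmf X \<times> B \<times> E. (joint P i)\<^sup>2 / ideal R i)
      = (\<Sum>x\<in>set_pmf X. \<Sum>b\<in>B. \<Sum>e\<in>E. M * (pmf X x * (push (f x) A P (b, e))\<^sup>2) / R e)"
    unfolding sum_cartesian_triple joint_def ideal_def
    by (intro sum.cong refl) (auto simp: power2_eq_square set_pmf_iff)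
  also have "\<dots> = (\<Sum>e\<in>E. M * (\<Sum>x\<in>set_pmf X. pmf X x * (\<Sum>b\<in>B. (push (f x) A P (b, e))\<^sup>2)) / R e)"
    unfolding sum_distrib_left sum_divide_distrib
    by (subst (3) sum.swap, subst (2) sum.swap) (simp add: sum.swap[of _ B])
  also have "\<dots> = (\<Sum>e\<in>E. M * ((\<Sum>x\<in>set_pmf X. pmf X x *
      (\<Sum>b\<in>B. (push (f x) A P (b, e) - marginal A P e / M)\<^sup>2)) + (marginal A P e)\<^sup>2 / M) / R e)"
  proof (rule sum.cong[OF refl])
    fix e
    have "(\<Sum>x\<in>set_pmf X. pmf X x * (\<Sum>b\<in>B. (push (f x) A P (b, e))\<^sup>2))
        = (\<Sum>x\<in>set_pmf X. pmf X x * ((\<Sum>b\<in>B. (push (f x) A P (b, e) - marginal A P e / M)\<^sup>2)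
            + (marginal A P e)\<^sup>2 / M))"
      by (intro sum.cong refl) (simp only: push)
    then show "M * (\<Sum>x\<in>set_pmf X. pmf X x * (\<Sum>b\<in>B. (push (f x) A P (b, e))\<^sup>2)) / R e
        = M * ((\<Sum>x\<in>set_pmf X. pmf X x * (\<Sum>b\<in>B. (push (f x) A P (b, e) - marginal A P e / M)\<^sup>2))
            + (marginal A P e)\<^sup>2 / M) / R e"
      by (simp only: distrib_left sum.distrib sum_pmf_mult)
  qed
  also have "\<dots> \<le> (\<Sum>e\<in>E. M * (\<epsilon> * (\<Sum>a\<in>A. (P (a, e))\<^sup>2) + (marginal A P e)\<^sup>2 / M) / R e)"
    using R M_pos
    by (intro sum_mono divide_right_mono mult_left_mono add_right_mono variance_push_le) auto
  also have "\<dots> = (\<Sum>e\<in>E. (marginal A P e)\<^sup>2 / R e) + \<epsilon> * M * (\<Sum>e\<in>E. \<Sum>a\<in>A. (P (a, e))\<^sup>2 / R e)"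
    using M_pos by (simp add: distrib_left add_divide_distrib sum.distrib sum_distrib_left
        sum_divide_distrib mult_ac)
  also have "(\<Sum>e\<in>E. \<Sum>a\<in>A. (P (a, e))\<^sup>2 / R e) = (\<Sum>a\<in>A. \<Sum>e\<in>E. (P (a, e))\<^sup>2 / R e)"
    by (rule sum.swap)
  finally show ?thesis .
qed

text \<open>The probability of \<open>x\<close>, positive on the support, cancels in the quotient.
  An average of divergences thus becomes a single one, and Jensen's inequality applies once for all
  \<open>x\<close>.\<close>

lemma expectation_I'_eq:
  "measure_pmf.expectation X (\<lambda>x. I' A E B (f x) P)
    = (\<Sum>i\<in>set_pmf X \<times> B \<times> E. joint P i * ln (joint P i / ideal (marginal A P) i))"
  unfolding expectation_eq I'_def sum_distrib_left sum_cartesian_triple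
proof (intro sum.cong refl, clarify)
  fix x b e assume "x \<in> set_pmf X"
  then have "joint P (x, b, e) / ideal (marginal A P) (x, b, e) = M * push (f x) A P (b, e) / marginal A P e"
    by (simp add: joint_def ideal_def set_pmf_iff)
  then show "pmf X x * (push (f x) A P (b, e) * ln (M * push (f x) A P (b, e) / marginal A P e))
      = joint P (x, b, e) * ln (joint P (x, b, e) / ideal (marginal A P) (x, b, e))"
    by (simp add: joint_def)
qed

lemma joint_nonneg:
  assumes "\<forall>s\<in>A \<times> E. 0 \<le> P s" and "i \<in> set_pmf X \<times> B \<times> E"
  shows "0 \<le> joint P i"
proof -
  obtain x b e where i: "i = (x, b, e)" by (cases i)
  then have "0 \<le> push (f x) A P (b, e)" using assms by (intro push_nonneg) auto
  then show ?thesis by (simp add: i joint_def)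
qed

lemma ideal_nonneg:
  assumes "\<And>e. e \<in> E \<Longrightarrow> 0 \<le> R e" and "i \<in> set_pmf X \<times> B \<times> E"
  shows "0 \<le> ideal R i"
  using assms by (auto simp: ideal_def)

text \<open>A hash value together with \<open>e\<close> has at most the mass of \<open>e\<close>.
  This is the density bound that charges mass outside the common part at \<open>ln M\<close> per
  unit.\<close>

lemma joint_le_ideal:
  assumes "\<forall>s\<in>A \<times> E. 0 \<le> P s" and "i \<in> set_pmf X \<times> B \<times> E"
  shows "joint P i \<le> M * ideal (marginal A P) i"
proof -
  obtain x b e where i: "i = (x, b, e)" by (cases i)
  then have "push (f x) A P (b, e) \<le> marginal A P e"
    using assms finite_A by (intro push_le_marginal) auto
  then show ?thesis using M_pos by (simp add: i joint_def ideal_def mult_left_mono)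
qed

text \<open>Jensen's inequality moves the logarithm outside and leaves the second moment of the
  density, in which the marginal term is the total mass 1.\<close>

lemma expectation_I'_le_ln:
  assumes "finite E" and P: "dist_on (A \<times> E) P"
  shows "measure_pmf.expectation X (\<lambda>x. I' A E B (f x) P)
    \<le> ln (1 + \<epsilon> * M * (\<Sum>a\<in>A. \<Sum>e\<in>E. (P (a, e))\<^sup>2 / marginal A P e))"
proof -
  let ?I = "set_pmf X \<times> B \<times> E" and ?r = "ideal (marginal A P)"
  have fin: "finite ?I" using finite_X finite_B \<open>finite E\<close> by simp
  have P0: "\<forall>s\<in>A \<times> E. 0 \<le> P s" using P by (simp add: dist_on_def)
  then have marg: "0 \<le> marginal A P e" if "e \<in> E" for e using that by (intro marginal_nonneg) auto
  have g: "0 \<le> joint P i" "joint P i \<le> M * ?r i" "0 \<le> ?r i" if "i \<in> ?I" for i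
    using joint_nonneg[OF P0 that] joint_le_ideal[OF P0 that] ideal_nonneg[where R = "marginal A P", OF marg that] by blast+
  have pos: "0 < joint P i / ?r i" if i: "i \<in> ?I" "0 < joint P i" for i
  proof -
    have "?r i \<noteq> 0" using g(2)[OF i(1)] i(2) by auto
    then show ?thesis using g(3)[OF i(1)] i(2) by simp
  qed
  have sum_g: "sum (joint P) ?I = 1" using P by (simp add: sum_joint dist_on_def)
  have "(\<Sum>i\<in>?I. joint P i * ln (joint P i / ?r i))
      \<le> sum (joint P) ?I * ln ((\<Sum>i\<in>?I. joint P i * (joint P i / ?r i)) / sum (joint P) ?I)"
    using fin g(1) pos by (rule sum_mult_ln_le) (simp_all only: sum_g zero_less_one)
  then have "measure_pmf.expectation X (\<lambda>x. I' A E B (f x) P)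
      \<le> ln (\<Sum>i\<in>?I. joint P i * (joint P i / ?r i))"
    unfolding expectation_I'_eq sum_g by (simp only: mult_1_left div_by_1)
  also have "\<dots> \<le> ln (1 + \<epsilon> * M * (\<Sum>a\<in>A. \<Sum>e\<in>E. (P (a, e))\<^sup>2 / marginal A P e))"
  proof (rule ln_mono)
    have "\<not> (\<forall>j\<in>?I. joint P j \<le> 0)"
    proof
      assume "\<forall>j\<in>?I. joint P j \<le> 0"
      then have "sum (joint P) ?I \<le> 0" by (intro sum_nonpos) blast
      then show False unfolding sum_g by simp
    qed
    then obtain j where j: "j \<in> ?I" "0 < joint P j" by (meson not_le)
    have "0 \<le> joint P i * (joint P i / ?r i)" if "i \<in> ?I" for i using g[OF that] by simp
    then show "0 < (\<Sum>i\<in>?I. joint P i * (joint P i / ?r i))"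
      by (intro sum_pos2[OF fin j(1)] mult_pos_pos[OF j(2) pos[OF j]])
    \<comment> \<open>Where the marginal is 0 the quotient is \<open>0 / 0 = 0\<close>.\<close>
    have "(\<Sum>e\<in>E. (marginal A P e)\<^sup>2 / marginal A P e) = (\<Sum>e\<in>E. marginal A P e)"
      by (simp add: power2_eq_square)
    also have "\<dots> = 1" using P by (simp add: sum_marginal dist_on_def)
    finally show "(\<Sum>i\<in>?I. joint P i * (joint P i / ?r i))
        \<le> 1 + \<epsilon> * M * (\<Sum>a\<in>A. \<Sum>e\<in>E. (P (a, e))\<^sup>2 / marginal A P e)"
      using sum_power2_joint_le[of E "marginal A P" P] marg by (simp add: power2_eq_square)
  qed
  finally show ?thesis .
qed

text \<open>\<open>relative_entropy_le\<close> is applied to \<open>joint P\<close> and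
  \<open>joint P'\<close> against \<open>ideal\<close>. Domination of the marginals turns the
  marginal term of the second moment into at most the mass of \<open>P'\<close>, as
  \<open>chi\<close> requires; distance at most 1/2 lets \<open>entropy_term_reflect\<close> produce
  the logarithmic term of \<open>eta\<close>.\<close>

lemma expectation_I'_le_eta:
  assumes "finite E" and P: "dist_on (A \<times> E) P" and P': "subdist_on (A \<times> E) P'"
    and marg_le: "\<And>e. e \<in> E \<Longrightarrow> marginal A P' e \<le> marginal A P e"
    and half: "l1_dist (A \<times> E) P P' \<le> 1/2"
  shows "measure_pmf.expectation X (\<lambda>x. I' A E B (f x) P)
    \<le> eta (l1_dist (A \<times> E) P P') (ln M)
      + \<epsilon> * M * (\<Sum>a\<in>A. \<Sum>e\<in>E. (P' (a, e))\<^sup>2 / marginal A P e)"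
proof -
  let ?I = "set_pmf X \<times> B \<times> E" and ?r = "ideal (marginal A P)" and ?\<delta> = "l1_dist (A \<times> E) P P'"
  let ?Y = "\<epsilon> * M * (\<Sum>a\<in>A. \<Sum>e\<in>E. (P' (a, e))\<^sup>2 / marginal A P e)"
  have fin: "finite ?I" using finite_X finite_B \<open>finite E\<close> by simp
  have P0: "\<forall>s\<in>A \<times> E. 0 \<le> P s" "\<forall>s\<in>A \<times> E. 0 \<le> P' s"
    using P P' by (simp_all add: dist_on_def subdist_on_def)
  then have marg: "0 \<le> marginal A P e" "0 \<le> marginal A P' e" if "e \<in> E" for e
    using that by (auto intro!: marginal_nonneg)
  have "(\<Sum>e\<in>E. (marginal A P' e)\<^sup>2 / marginal A P e) \<le> (\<Sum>e\<in>E. marginal A P' e)"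
  proof (rule sum_mono)
    fix e assume e: "e \<in> E"
    show "(marginal A P' e)\<^sup>2 / marginal A P e \<le> marginal A P' e"
    proof (cases "marginal A P e = 0")
      case False
      then show ?thesis using marg[OF e] marg_le[OF e]
        by (simp add: divide_le_eq power2_eq_square mult_left_mono)
    qed (use marg[OF e] in simp)
  qed
  then have chi: "(\<Sum>i\<in>?I. (joint P' i)\<^sup>2 / ?r i) \<le> sum (joint P') ?I + ?Y"
    using sum_power2_joint_le[of E "marginal A P" P'] marg by (simp add: sum_joint sum_marginal)
  have "0 \<le> ?Y" using \<epsilon>_nonneg marg by (intro mult_nonneg_nonneg sum_nonneg) auto
  then have "measure_pmf.expectation X (\<lambda>x. I' A E B (f x) P)
      \<le> ?\<delta> * ln M - (1 - ?\<delta>) * ln (1 - ?\<delta>) + ?Y"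
    unfolding expectation_I'_eq
  proof (intro relative_entropy_le[where h = "joint P'", OF fin _ _ _ _ _ sum_abs_joint_diff_le _ chi])
    show "0 \<le> joint P i" "0 \<le> joint P' i" "0 \<le> ?r i" "joint P i \<le> M * ?r i" if "i \<in> ?I" for i
      using joint_nonneg[OF P0(1) that] joint_nonneg[OF P0(2) that] ideal_nonneg[where R = "marginal A P", OF marg(1) that]
        joint_le_ideal[OF P0(1) that] by blast+
    show "sum (joint P) ?I = 1" using P by (simp add: sum_joint dist_on_def)
  qed (use half in simp)
  moreover have "?\<delta> * ln ?\<delta> \<le> (1 - ?\<delta>) * ln (1 - ?\<delta>)"
    using half by (intro entropy_term_reflect) (auto simp: l1_dist_def intro: sum_nonneg)
  ultimately show ?thesis by (simp add: eta_def)
qed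

text \<open>Supplies the support condition for entropies relative to a marginal. The form
  \<open>\<le> 0\<close> also fits a \<open>P'\<close> whose marginal is dominated by one that
  vanishes at \<open>e\<close>.\<close>

lemma marginal_eq_0:
  assumes "\<And>a. a \<in> A \<Longrightarrow> 0 \<le> P (a, e)" "marginal A P e \<le> 0" "a \<in> A"
  shows "P (a, e) = 0"
proof -
  have "marginal A P e = 0" using assms(2) marginal_nonneg[of A P e] assms(1) by simp
  then show ?thesis using assms finite_A by (simp add: marginal_def sum_nonneg_eq_0_iff)
qed

text \<open>Domination of the marginals excludes the entropy \<open>-\<infinity>\<close>, so each
  admissible \<open>P'\<close> reduces to a real inequality.\<close>

lemma expectation_I'_le_Delta_I2:
  assumes "finite E" and P: "dist_on (A \<times> E) P"
  shows "ereal (measure_pmf.expectation X (\<lambda>x. I' A E B (f x) P)) \<le> Delta_I2 A E M \<epsilon> P"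
  unfolding Delta_I2_def
proof (intro INF_greatest)
  fix P' assume "P' \<in> {P'. subdist_on (A \<times> E) P' \<and> (\<forall>e\<in>E. marginal A P' e \<le> marginal A P e)
      \<and> l1_dist (A \<times> E) P P' \<le> 1/2}"
  then have P': "subdist_on (A \<times> E) P'" and le: "\<And>e. e \<in> E \<Longrightarrow> marginal A P' e \<le> marginal A P e"
    and half: "l1_dist (A \<times> E) P P' \<le> 1/2" by auto
  have "ereal_exp (- H2 A E P' (marginal A P)) = ereal (\<Sum>a\<in>A. \<Sum>e\<in>E. (P' (a, e))\<^sup>2 / marginal A P e)"
  proof (rule ereal_exp_uminus_H2)
    show "0 \<le> marginal A P e" if "e \<in> E" for e
      using P that by (intro marginal_nonneg) (auto simp: dist_on_def)
    show "P' (a, e) = 0" if "a \<in> A" "e \<in> E" "marginal A P e = 0" for a e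
      using P' le[OF that(2)] that by (intro marginal_eq_0) (auto simp: subdist_on_def)
  qed
  then show "ereal (measure_pmf.expectation X (\<lambda>x. I' A E B (f x) P))
      \<le> ereal (eta (l1_dist (A \<times> E) P P') (ln M))
        + ereal (\<epsilon> * M) * ereal_exp (- H2 A E P' (marginal A P))"
    using expectation_I'_le_eta[OF assms P' le half] by simp
qed

lemma expectation_I'_le_H2_down:
  assumes "finite E" and P: "dist_on (A \<times> E) P"
  shows "ereal (measure_pmf.expectation X (\<lambda>x. I' A E B (f x) P))
      \<le> ereal_ln (1 + ereal (\<epsilon> * M) * ereal_exp (- H2_down A E P))"
    and "ereal_ln (1 + ereal (\<epsilon> * M) * ereal_exp (- H2_down A E P))
      \<le> ereal (\<epsilon> * M) * ereal_exp (- H2_down A E P)"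
proof -
  define s where "s = (\<Sum>a\<in>A. \<Sum>e\<in>E. (P (a, e))\<^sup>2 / marginal A P e)"
  have marg: "0 \<le> marginal A P e" if "e \<in> E" for e
    using P that by (intro marginal_nonneg) (auto simp: dist_on_def)
  have "P (a, e) = 0" if "a \<in> A" "e \<in> E" "marginal A P e = 0" for a e
    using P that by (intro marginal_eq_0) (auto simp: dist_on_def)
  then have H2: "ereal_exp (- H2_down A E P) = ereal s"
    unfolding H2_down_def s_def by (intro ereal_exp_uminus_H2 marg)
  have "0 \<le> \<epsilon> * M * s"
    unfolding s_def using \<epsilon>_nonneg marg by (intro mult_nonneg_nonneg sum_nonneg) auto
  \<comment> \<open>The argument of \<open>ereal_ln\<close> is at least 1, so its real branch
    applies.\<close>
  then have ln: "ereal_ln (1 + ereal (\<epsilon> * M) * ereal s) = ereal (ln (1 + \<epsilon> * M * s))"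
    and le: "ln (1 + \<epsilon> * M * s) \<le> \<epsilon> * M * s"
    by (auto simp: ereal_ln_def one_ereal_def ln_add_one_self_le_self)
  show "ereal (measure_pmf.expectation X (\<lambda>x. I' A E B (f x) P))
      \<le> ereal_ln (1 + ereal (\<epsilon> * M) * ereal_exp (- H2_down A E P))"
    unfolding H2 ln using expectation_I'_le_ln[OF assms] by (simp add: s_def)
  show "ereal_ln (1 + ereal (\<epsilon> * M) * ereal_exp (- H2_down A E P))
      \<le> ereal (\<epsilon> * M) * ereal_exp (- H2_down A E P)"
    unfolding H2 ln using le by simp
qed

end

section \<open>Almost dual universal families of linear hash functions\<close>

lemma almost_dual_universal2_small_variance_hash:
  fixes f :: "'x \<Rightarrow> 'k::{field,finite} Matrix.vec \<Rightarrow> 'k Matrix.vec"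
  assumes "finite (set_pmf X)" "linear_hash N m X f"
    and surj: "\<And>x. x \<in> set_pmf X \<Longrightarrow> f x ` carrier_vec N = carrier_vec m"
    and "almost_dual_universal2 N m \<epsilon> X f" "0 \<le> \<epsilon>"
  shows "small_variance_hash (carrier_vec N) (carrier_vec m) X f \<epsilon>"
proof
  show "carrier_vec m \<noteq> ({} :: 'k Matrix.vec set)" using zero_carrier_vec[of m] by blast
  show "f x ` carrier_vec N \<subseteq> carrier_vec m" if "x \<in> set_pmf X" for x
    using surj[OF that] by simp
  show "(\<Sum>x\<in>set_pmf X. pmf X x * (\<Sum>b\<in>carrier_vec m. ((\<Sum>a\<in>{a\<in>carrier_vec N. f x a = b}. g a)
      - sum g (carrier_vec N) / real (card (carrier_vec m :: 'k Matrix.vec set)))\<^sup>2))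
    \<le> \<epsilon> * (\<Sum>a\<in>carrier_vec N. (g a)\<^sup>2)" for g
    unfolding card_carrier_vec_finite using assms by (intro expectation_power2_deviation_hash_le)
qed (use assms in \<open>simp_all add: finite_carrier_vec_finite\<close>)

theorem theorem15:
  fixes N m :: nat and \<epsilon> :: real
    and X :: "'x pmf"
    and f :: "'x \<Rightarrow> 'k::{field,finite} Matrix.vec \<Rightarrow> 'k Matrix.vec"
    and E :: "'e set" and Q :: "'e \<Rightarrow> real"
    and P :: "'k Matrix.vec \<times> 'e \<Rightarrow> real"
  assumes "m \<le> N"
    and "finite E"
    and "dist_on E Q"
    and "subdist_on (carrier_vec N \<times> E) P"
    and "0 \<le> \<epsilon>"
    and "finite (set_pmf X)"
    and "linear_hash N m X f"
    and surj: "\<And>x. x \<in> set_pmf X \<Longrightarrow> f x ` carrier_vec N = carrier_vec m"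
    and "almost_dual_universal2 N m \<epsilon> X f"
  shows
    "ereal (measure_pmf.expectation X (\<lambda>x. d1' (carrier_vec N) E (carrier_vec m) (f x) P))
       \<le> ereal (sqrt \<epsilon> * (real (CARD('k) ^ m)) powr (1/2))
           * ereal_exp (ereal (- (1/2)) * H2 (carrier_vec N) E P Q)
     \<and> ereal (measure_pmf.expectation X (\<lambda>x. d1' (carrier_vec N) E (carrier_vec m) (f x) P))
       \<le> Delta_d2 (carrier_vec N) E (real (CARD('k) ^ m)) \<epsilon> P
     \<and> (dist_on (carrier_vec N \<times> E) P \<longrightarrow>
          ereal (measure_pmf.expectation X (\<lambda>x. I' (carrier_vec N) E (carrier_vec m) (f x) P))
            \<le> ereal_ln (1 + ereal (\<epsilon> * real (CARD('k) ^ m))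
                * ereal_exp (- H2_down (carrier_vec N) E P))
        \<and> ereal_ln (1 + ereal (\<epsilon> * real (CARD('k) ^ m))
                * ereal_exp (- H2_down (carrier_vec N) E P))
            \<le> ereal (\<epsilon> * real (CARD('k) ^ m)) * ereal_exp (- H2_down (carrier_vec N) E P)
        \<and> ereal (measure_pmf.expectation X (\<lambda>x. I' (carrier_vec N) E (carrier_vec m) (f x) P))
            \<le> Delta_I2 (carrier_vec N) E (real (CARD('k) ^ m)) \<epsilon> P)"
proof -
  \<comment> \<open>From here on only the variance bound is used; the constant \<open>M\<close> of
    the locale is the size of the target space.\<close>
  interpret small_variance_hash "carrier_vec N" "carrier_vec m" X f \<epsilon>
    using assms by (intro almost_dual_universal2_small_variance_hash)
  have M: "real (CARD('k) ^ m) = M" by (simp add: card_carrier_vec_finite)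
  show ?thesis
    unfolding M using assms
    by (intro conjI impI expectation_d1'_le_H2 expectation_d1'_le_Delta_d2 expectation_I'_le_H2_down
        expectation_I'_le_Delta_I2)
qed

end
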